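(* Let $q$ be a complex number with $0<|q|<1$ and let $a,b,c,d$ be nonzero complex numbers such that no denominator occurring below vanishes. Then $$\frac{(b;q)_\infty(c;q)_\infty(qd;q)_\infty(qa^2/bcd;q)_\infty}{(qa/b;q)_\infty(qa/c;q)_\infty(a/d;q)_\infty(bcd/a;q)_\infty} =1+\sum_{n=1}^{\infty}W_n(a,b,c,d)\left(\frac{q^{3n-2}a^3}{bcd}\right)^n\frac{(b,\,c,\,d,\,qa/bc,\,qa/bd,\,a/cd;q)_n\,(bc/a,\,bd/a,\,cd/a;q)_{2n}}{(a/b,\,a/c,\,a/d;q)_{2n}\,(q,\,bcd/a;q)_{3n}},$$ where $$W_n(a,b,c,d)=\frac{(1-q^{3n})(1-b/a)(1-c/a)(1-q^{3n-1}bcd/a)(1-q^{4n-2}b)}{(1-cd/a)(1-1/d)(1-q^{n-1}b)(1-q^{2n-1}bc/a)(1-q^{2n-1}bd/a)}$$ $$\times\Bigg\{1-\frac{(1-q^{n-1}b)(1-q^{2n-1}bc/a)(1-q^{2n-1}bd/a)(1-q^{n}a/(cd))(1-q^{4n}d)}{(1-q^{3n})(1-q^{-2n}b/a)(1-q^{2n}a/c)(1-q^{3n-1}bcd/a)(1-q^{4n-2}b)}$$ $$-\frac{(1-q^{3n-1})(1-q^{1-2n}c/a)(1-q^{2n-1}a/d)(1-q^{3n-2}bcd/a)(1-q^{4n-3}c)}{(1-q^{n-1}c)(1-q^{2n-2}bc/a)(1-q^{n}a/(bd))(1-q^{2n-1}cd/a)(1-q^{4n-2}b)}\Bigg\}.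$$
   Context: $(x;q)_0=1$, $(x;q)_n=\prod_{j=0}^{n-1}(1-q^jx)$ for $n\ge1$, $(x;q)_\infty=\prod_{j\ge0}(1-q^jx)$, and $(x_1,\dots,x_r;q)_n=(x_1;q)_n\cdots(x_r;q)_n$. Expressions such as $qa/bc$ mean $qa/(bc)$. *)

theory Defs
  imports "HOL-Analysis.Analysis"
begin

definition qpoch :: "complex \<Rightarrow> complex \<Rightarrow> nat \<Rightarrow> complex" where
  "qpoch x q n = (\<Prod>j<n. 1 - q ^ j * x)"

definition qpoch_inf :: "complex \<Rightarrow> complex \<Rightarrow> complex" where
  "qpoch_inf x q = (\<Prod>j. 1 - q ^ j * x)"

definition qpochs :: "complex list \<Rightarrow> complex \<Rightarrow> nat \<Rightarrow> complex" where
  "qpochs xs q n = (\<Prod>x\<leftarrow>xs. qpoch x q n)"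

text \<open>The following definitions are only used for \<open>n \<ge> 1\<close>. Exponents such as \<open>-2n\<close> and
  \<open>1 - 2n\<close> are negative there, whence the integer powers.\<close>

definition W ::
  "complex \<Rightarrow> nat \<Rightarrow> complex \<Rightarrow> complex \<Rightarrow> complex \<Rightarrow> complex \<Rightarrow> complex" where
  "W q n a b c d = (let N = int n in
     ((1 - q powi (3*N)) * (1 - b/a) * (1 - c/a)
        * (1 - q powi (3*N - 1) * (b*c*d/a)) * (1 - q powi (4*N - 2) * b))
     / ((1 - c*d/a) * (1 - 1/d) * (1 - q powi (N - 1) * b)
        * (1 - q powi (2*N - 1) * (b*c/a)) * (1 - q powi (2*N - 1) * (b*d/a)))
     * (1
        - ((1 - q powi (N - 1) * b) * (1 - q powi (2*N - 1) * (b*c/a))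
             * (1 - q powi (2*N - 1) * (b*d/a)) * (1 - q powi N * (a/(c*d)))
             * (1 - q powi (4*N) * d))
          / ((1 - q powi (3*N)) * (1 - q powi (- 2*N) * (b/a))
             * (1 - q powi (2*N) * (a/c)) * (1 - q powi (3*N - 1) * (b*c*d/a))
             * (1 - q powi (4*N - 2) * b))
        - ((1 - q powi (3*N - 1)) * (1 - q powi (1 - 2*N) * (c/a))
             * (1 - q powi (2*N - 1) * (a/d)) * (1 - q powi (3*N - 2) * (b*c*d/a))
             * (1 - q powi (4*N - 3) * c))
          / ((1 - q powi (N - 1) * c) * (1 - q powi (2*N - 2) * (b*c/a))
             * (1 - q powi N * (a/(b*d))) * (1 - q powi (2*N - 1) * (c*d/a))
             * (1 - q powi (4*N - 2) * b))))"

definition summand ::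
  "complex \<Rightarrow> nat \<Rightarrow> complex \<Rightarrow> complex \<Rightarrow> complex \<Rightarrow> complex \<Rightarrow> complex" where
  "summand q n a b c d =
     W q n a b c d * (q powi (3 * int n - 2) * a ^ 3 / (b*c*d)) ^ n
     * ((qpochs [b, c, d, q*a/(b*c), q*a/(b*d), a/(c*d)] q n
           * qpochs [b*c/a, b*d/a, c*d/a] q (2*n))
        / (qpochs [a/b, a/c, a/d] q (2*n) * qpochs [q, b*c*d/a] q (3*n)))"

text \<open>Every denominator of the infinite product quotient, of \<^const>\<open>summand\<close> and of \<^const>\<open>W\<close>
  is nonzero. The conditions are read off before any cancellation between factors.\<close>

definition no_zero_denominator ::
  "complex \<Rightarrow> complex \<Rightarrow> complex \<Rightarrow> complex \<Rightarrow> complex \<Rightarrow> bool" where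
  "no_zero_denominator q a b c d \<longleftrightarrow>
     qpoch_inf (q*a/b) q \<noteq> 0 \<and> qpoch_inf (q*a/c) q \<noteq> 0 \<and>
     qpoch_inf (a/d) q \<noteq> 0 \<and> qpoch_inf (b*c*d/a) q \<noteq> 0 \<and>
     (\<forall>n\<ge>1. qpochs [a/b, a/c, a/d] q (2*n) \<noteq> 0 \<and> qpochs [q, b*c*d/a] q (3*n) \<noteq> 0) \<and>
     1 - c*d/a \<noteq> 0 \<and> 1 - 1/d \<noteq> 0 \<and>
     (\<forall>n\<ge>1. let N = int n in
        1 - q powi (N - 1) * b \<noteq> 0 \<and>
        1 - q powi (2*N - 1) * (b*c/a) \<noteq> 0 \<and>
        1 - q powi (2*N - 1) * (b*d/a) \<noteq> 0 \<and>
        1 - q powi (3*N) \<noteq> 0 \<and>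
        1 - q powi (- 2*N) * (b/a) \<noteq> 0 \<and>
        1 - q powi (2*N) * (a/c) \<noteq> 0 \<and>
        1 - q powi (3*N - 1) * (b*c*d/a) \<noteq> 0 \<and>
        1 - q powi (4*N - 2) * b \<noteq> 0 \<and>
        1 - q powi (N - 1) * c \<noteq> 0 \<and>
        1 - q powi (2*N - 2) * (b*c/a) \<noteq> 0 \<and>
        1 - q powi N * (a/(b*d)) \<noteq> 0 \<and>
        1 - q powi (2*N - 1) * (c*d/a) \<noteq> 0)"

end

theory Submission
  imports Defs "HOL-Complex_Analysis.Complex_Analysis"
begin

text \<open>
  Let \<open>\<Omega>(a; b, c, d, e; z)\<close> be the sum over \<open>k\<close> of
  \<open>(1 - a q\<^sup>2\<^sup>k) (b, c, d, e; q)\<^sub>k / (qa/b, qa/c, qa/d, qa/e; q)\<^sub>k z\<^sup>k\<close> with \<open>b c d e z = q a\<^sup>2\<close>.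
  Abel summation relates it to \<open>\<Omega>(qa; b, c, d, qe; qz)\<close>, with an explicit boundary term. If
  \<open>e = a\<close>, this term vanishes, and iterating \<open>a \<mapsto> qa\<close> evaluates \<open>\<Omega>\<close> (the very-well-poised
  \<open>\<^sub>6\<phi>\<^sub>5\<close> sum); the left-hand side of the theorem is the value of
  \<open>\<Omega>(d; d, bd/a, cd/a, qa/bc; a/d) / (1 - d)\<close>. On the other hand, dropping the term \<open>k = 0\<close> and then
  applying the relation to \<open>e = cd/a\<close> and to \<open>e = bd/a\<close> multiplies the five parameters by
  \<open>q\<^sup>4, q, q\<^sup>2, q\<^sup>2, q\<close>. The boundary terms of the two relations in the \<open>n\<close>-th round, together with the
  next term \<open>k = 0\<close>, are the three terms in the braces of \<open>W\<^sub>n\<close>.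

  The series \<open>\<Omega>\<close> need not converge, so this is done only for \<open>a = q\<^sup>K bd\<close>, where it terminates. Keep
  \<open>b\<close>, \<open>d\<close> and \<open>\<kappa> = c/a\<close> fixed: after clearing denominators both sides are entire functions
  of \<open>a\<close>, and the points \<open>q\<^sup>K bd\<close> accumulate at \<open>0\<close>.
\<close>

section \<open>Infinite q-shifted factorials\<close>

lemma qpoch_0 [simp]: "qpoch x q 0 = 1"
  by (simp add: qpoch_def)

lemma qpoch_Suc: "qpoch x q (Suc n) = qpoch x q n * (1 - q ^ n * x)"
  by (simp add: qpoch_def)

lemma qpoch_add: "qpoch x q (m + n) = qpoch x q m * qpoch (q ^ m * x) q n"
  by (induction n) (simp_all add: qpoch_Suc power_add algebra_simps)

lemma qpoch_Suc_head: "qpoch x q (Suc n) = (1 - x) * qpoch (q * x) q n"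
  using qpoch_add[of x q 1 n] by (simp add: qpoch_Suc)

lemma qpoch_shift: "(1 - x) * qpoch (q * x) q n = qpoch x q n * (1 - q ^ n * x)"
  by (metis qpoch_Suc qpoch_Suc_head)

lemma qpoch_eq_0_iff: "qpoch x q n = 0 \<longleftrightarrow> (\<exists>j<n. q ^ j * x = 1)"
  unfolding qpoch_def by (auto intro: sym)

lemma qpoch_eq_0_mono: "qpoch x q n = 0 \<Longrightarrow> n \<le> k \<Longrightarrow> qpoch x q k = 0"
  unfolding qpoch_eq_0_iff by (meson less_le_trans)

text \<open>Each factor is at most \<open>exp (norm q ^ j * norm x)\<close> because
  \<open>1 + t \<le> exp t\<close>, and the exponents form a geometric series. The bound is
  independent of \<open>n\<close>; later this bounds the terms of all rounds at once.\<close>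

lemma norm_qpoch_le:
  assumes "norm q < 1"
  shows "norm (qpoch x q n) \<le> exp (norm x / (1 - norm q))"
proof -
  have "norm (qpoch x q n) = (\<Prod>j<n. norm (1 - q ^ j * x))"
    by (simp add: qpoch_def prod_norm)
  also have "\<dots> \<le> (\<Prod>j<n. exp (norm q ^ j * norm x))"
  proof (rule prod_mono, safe)
    fix j
    have "norm (1 - q ^ j * x) \<le> 1 + norm q ^ j * norm x"
      using norm_triangle_ineq4[of 1 "q ^ j * x"] by (simp add: norm_mult norm_power)
    also have "\<dots> \<le> exp (norm q ^ j * norm x)"
      by (rule exp_ge_add_one_self)
    finally show "norm (1 - q ^ j * x) \<le> exp (norm q ^ j * norm x)" .
  qed simp
  also have "\<dots> = exp ((\<Sum>j<n. norm q ^ j) * norm x)"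
    by (simp add: exp_sum sum_distrib_right)
  also have "(\<Sum>j<n. norm q ^ j) \<le> (\<Sum>j. norm q ^ j)"
    using assms by (intro sum_le_suminf summable_geometric) auto
  hence "exp ((\<Sum>j<n. norm q ^ j) * norm x) \<le> exp (norm x / (1 - norm q))"
    using assms by (simp add: suminf_geometric mult_left_mono divide_inverse mult.commute)
  finally show ?thesis .
qed

lemma convergent_prod_qpoch:
  fixes q x :: complex
  assumes "norm q < 1"
  shows "convergent_prod (\<lambda>j. 1 - q ^ j * x)"
proof -
  have "summable (\<lambda>j. norm q ^ j * norm x)"
    using assms by (intro summable_mult2 summable_geometric) auto
  hence "summable (\<lambda>j. norm ((1 - q ^ j * x) - 1))"
    by (simp add: norm_mult norm_power)
  thus ?thesis
    by (intro abs_convergent_prod_imp_convergent_prod summable_imp_abs_convergent_prod)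
qed

lemma qpoch_tendsto:
  assumes "norm q < 1"
  shows "qpoch x q \<longlonglongrightarrow> qpoch_inf x q"
proof -
  have "(\<lambda>n. qpoch x q (Suc n)) \<longlonglongrightarrow> qpoch_inf x q"
    using convergent_prod_LIMSEQ[OF convergent_prod_qpoch[OF assms, of x]]
    by (simp add: qpoch_def qpoch_inf_def lessThan_Suc_atMost)
  thus ?thesis
    by (simp only: filterlim_sequentially_Suc)
qed

lemma qpoch_inf_split:
  assumes "norm q < 1"
  shows "qpoch_inf x q = qpoch x q n * qpoch_inf (q ^ n * x) q"
proof (rule LIMSEQ_unique)
  show "(\<lambda>m. qpoch x q (n + m)) \<longlonglongrightarrow> qpoch_inf x q"
    using LIMSEQ_ignore_initial_segment[OF qpoch_tendsto[OF assms], where k = n]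
    by (simp add: add.commute)
  show "(\<lambda>m. qpoch x q (n + m)) \<longlonglongrightarrow> qpoch x q n * qpoch_inf (q ^ n * x) q"
    unfolding qpoch_add by (intro tendsto_mult_left qpoch_tendsto assms)
qed

lemma norm_qpoch_inf_le:
  assumes "norm q < 1"
  shows "norm (qpoch_inf x q) \<le> exp (norm x / (1 - norm q))"
  by (rule LIMSEQ_le_const2[OF tendsto_norm[OF qpoch_tendsto]]) (use assms norm_qpoch_le in auto)

text \<open>A convergent product vanishes only through one of its factors; conversely,
  \<open>qpoch_inf_split\<close> exposes a vanishing factor.\<close>

lemma qpoch_inf_eq_0_iff:
  assumes "norm q < 1"
  shows "qpoch_inf x q = 0 \<longleftrightarrow> (\<exists>j. q ^ j * x = 1)"
proof
  assume "qpoch_inf x q = 0"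
  thus "\<exists>j. q ^ j * x = 1"
    using prodinf_nonzero[OF convergent_prod_qpoch[OF assms, of x]]
    by (auto simp: qpoch_inf_def)
next
  assume "\<exists>j. q ^ j * x = 1"
  then obtain j where "q ^ j * x = 1" by blast
  hence "qpoch x q (Suc j) = 0"
    by (simp add: qpoch_Suc)
  thus "qpoch_inf x q = 0"
    using qpoch_inf_split[OF assms, of x "Suc j"] by simp
qed

section \<open>Holomorphy in the argument\<close>

lemma qpoch_holomorphic [holomorphic_intros]:
  assumes "f holomorphic_on S"
  shows "(\<lambda>z. qpoch (f z) q n) holomorphic_on S"
  unfolding qpoch_def using assms by (intro holomorphic_intros)

lemma qpoch_inf_holomorphic [holomorphic_intros]:
  assumes "norm q < 1" and "f holomorphic_on S"
  shows "(\<lambda>z. qpoch_inf (f z) q) holomorphic_on S"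
proof -
  have "(\<lambda>z. qpoch_inf z q) holomorphic_on UNIV"
  proof (rule holomorphic_uniform_sequence)
    fix x :: complex
    let ?B = "cball x 1"
    \<comment> \<open>The M-test for the deviations of the factors from 1 yields uniform convergence
      of the partial products on the disc.\<close>
    have "uniformly_convergent_on ?B (\<lambda>N z. \<Sum>n<N. norm (1 - q ^ n * z - 1))"
    proof (rule Weierstrass_m_test')
      fix n z assume "z \<in> ?B"
      hence "norm z \<le> norm x + 1"
        using norm_triangle_ineq2[of z x] by (simp add: dist_norm norm_minus_commute)
      thus "norm (norm (1 - q ^ n * z - 1)) \<le> norm q ^ n * (norm x + 1)"
        by (simp add: norm_mult norm_power mult_left_mono)
    next
      show "summable (\<lambda>n. norm q ^ n * (norm x + 1))"
        using assms by (intro summable_mult2 summable_geometric) auto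
    qed
    hence "uniformly_convergent_on ?B (\<lambda>N z. qpoch z q N)"
      unfolding qpoch_def
      by (intro uniformly_convergent_on_prod') (auto intro!: continuous_intros)
    then obtain l where l: "uniform_limit ?B (\<lambda>N z. qpoch z q N) l sequentially"
      unfolding uniformly_convergent_on_def by blast
    have "l z = qpoch_inf z q" if "z \<in> ?B" for z
      using tendsto_uniform_limitI[OF l that] qpoch_tendsto[OF assms(1), of z] LIMSEQ_unique
      by blast
    hence "uniform_limit ?B (\<lambda>N z. qpoch z q N) (\<lambda>z. qpoch_inf z q) sequentially"
      using l uniform_limit_cong'[of ?B "\<lambda>N z. qpoch z q N" "\<lambda>N z. qpoch z q N" l "\<lambda>z. qpoch_inf z q"]
      by blast
    thus "\<exists>d>0. cball x d \<subseteq> UNIV \<and>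
        uniform_limit (cball x d) (\<lambda>N z. qpoch z q N) (\<lambda>z. qpoch_inf z q) sequentially"
      by (intro exI[of _ 1]) auto
  qed (auto intro!: holomorphic_intros)
  from holomorphic_on_compose[OF assms(2) holomorphic_on_subset[OF this]] show ?thesis
    by (simp add: o_def)
qed

lemma qpoch_0_left [simp]: "qpoch 0 q n = 1"
  by (simp add: qpoch_def)

lemma qpoch_nonzero_of_inf:
  assumes "norm q < 1" and "qpoch_inf x q \<noteq> 0"
  shows "qpoch x q k \<noteq> 0"
  using qpoch_inf_split[OF assms(1), of x k] assms(2) by auto

lemma qpoch_inf_q_nonzero:
  assumes "norm q < 1"
  shows "qpoch_inf q q \<noteq> 0"
proof
  assume "qpoch_inf q q = 0"
  then obtain j where "q ^ j * q = 1"
    using qpoch_inf_eq_0_iff[OF assms] by blast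
  hence "norm q ^ Suc j = 1"
    by (metis norm_one norm_power power_Suc2)
  thus False
    using assms power_Suc_less_one[of "norm q" j] by (cases "norm q = 0") auto
qed

lemma tendsto_qpoch:
  assumes "(f \<longlongrightarrow> x) F"
  shows "((\<lambda>i. qpoch (f i) q n) \<longlongrightarrow> qpoch x q n) F"
  unfolding qpoch_def by (intro tendsto_intros assms)

section \<open>Very-well-poised sums\<close>

text \<open>The very-well-poised factor \<open>1 - q^(2*k)*a\<close> is left to
  \<open>wp_sum\<close>, so that consecutive terms differ by linear factors in \<open>q^k\<close>
  only. The argument \<open>z\<close> is free; the balancing condition is imposed in the
  lemmas.\<close>

definition wp_summand ::
  "complex \<Rightarrow> complex \<Rightarrow> complex \<Rightarrow> complex \<Rightarrow> complex \<Rightarrow> complex \<Rightarrow> complex \<Rightarrow> nat \<Rightarrow> complex" where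
  "wp_summand q a b c d e z k =
     qpoch b q k * qpoch c q k * qpoch d q k * qpoch e q k
       / (qpoch (q*a/b) q k * qpoch (q*a/c) q k * qpoch (q*a/d) q k * qpoch (q*a/e) q k) * z ^ k"

text \<open>Only partial sums are formed, as the full series may diverge. In a terminating case with
  \<open>n\<close> large enough they are the whole sum.\<close>

definition wp_sum ::
  "complex \<Rightarrow> complex \<Rightarrow> complex \<Rightarrow> complex \<Rightarrow> complex \<Rightarrow> complex \<Rightarrow> complex \<Rightarrow> nat \<Rightarrow> complex" where
  "wp_sum q a b c d e z n = (\<Sum>k<n. (1 - q ^ (2*k) * a) * wp_summand q a b c d e z k)"

section \<open>The Abel summation relation\<close>

text \<open>In both products the coefficients of \<open>x\<close> multiply to \<open>A^2\<close>, so
  the difference has no constant and no quartic term. The substitution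
  \<open>x \<mapsto> 1/(A*x)\<close> exchanges the products up to the factor \<open>A^2*x^4\<close>,
  so the difference also vanishes where \<open>A*x^2 = 1\<close>. The linear terms give the
  constant.\<close>

lemma balanced_product_difference:
  fixes A :: complex
  assumes "b \<noteq> 0" "c \<noteq> 0" "d \<noteq> 0" "A \<noteq> 0"
  shows "(1 - x*(A/b)) * (1 - x*(A/c)) * (1 - x*(A/d)) * (1 - x*(b*c*d/A))
    - (1 - x*b) * (1 - x*c) * (1 - x*d) * (1 - x*(A^2/(b*c*d)))
    = - (b*c*d/A) * (1 - A/(b*c)) * (1 - A/(b*d)) * (1 - A/(c*d)) * x * (1 - A * x^2)"
  using assms by (simp add: divide_simps) algebra

text \<open>For \<open>x = q^k\<close> this is the telescoping step below at index \<open>k\<close>,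
  up to a common factor. The first fraction is the difference of two boundary terms, the second is
  the summand with \<open>a\<close>, \<open>e\<close>, \<open>z\<close> multiplied by
  \<open>q\<close>. The content is \<open>balanced_product_difference\<close> with
  \<open>A = q*a\<close>.\<close>

lemma wp_telescope_identity:
  fixes a b c d e q x z :: complex
  assumes nz: "a \<noteq> 0" "b \<noteq> 0" "c \<noteq> 0" "d \<noteq> 0" "e \<noteq> 0" "q \<noteq> 0"
    and z: "b*c*d*e*z = q*a^2" "z \<noteq> 1"
  defines "P \<equiv> (1 - x*(q*a/b)) * (1 - x*(q*a/c)) * (1 - x*(q*a/d))"
  shows "(1 - a*x^2) * P =
     (z * (1 - x*b) * (1 - x*c) * (1 - x*d) * (1 - x*e) * (1 - q*x*e*z)
      - (1 - x*a/e) * (1 - x*e*z) * P) / (z - 1)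
     + (a/e) * (1 - q*a/(b*c)) * (1 - q*a/(b*d)) * (1 - q*a/(c*d)) / (1 - z)
        * x * (1 - x*e) * (1 - q*a*x^2)"
proof -
  have znz: "z \<noteq> 0" using z nz by auto
  \<comment> \<open>The balancing condition identifies the fourth factors of the two products for
    \<open>A = q*a\<close>.\<close>
  have e1: "q*e*z = (q*a)^2/(b*c*d)" and e2: "a/(e*z) = b*c*d/(q*a)"
    using z(1) nz znz by (simp_all add: field_simps power2_eq_square)
  define R where "R = (1 - q*a/(b*c)) * (1 - q*a/(b*d)) * (1 - q*a/(c*d))"
  define Q where "Q = (1 - x*b) * (1 - x*c) * (1 - x*d) * (1 - q*x*e*z)"
  have k: "P * (1 - x*(a/(e*z))) - Q = - (a/(e*z)) * R * x * (1 - q*a*x^2)"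
    using balanced_product_difference[of b c d "q*a" x] nz unfolding P_def Q_def R_def e1[symmetric] e2[symmetric]
    by (simp add: mult_ac)
  have k': "P * (z - x*(a/e)) - z * Q = - (a/e) * R * x * (1 - q*a*x^2)"
  proof -
    have "z * (a/(e*z)) = a/e" using znz by simp
    thus ?thesis using k by algebra
  qed
  \<comment> \<open>This splits \<open>(z - 1) * (1 - a*x^2)\<close> into a part with the factor
    \<open>z - x*(a/e)\<close>, to which \<open>k'\<close> applies, and the boundary term at the
    lower index.\<close>
  have m: "(1 - a*x^2) * (z - 1) + (1 - x*a/e) * (1 - x*e*z) = (1 - x*e) * (z - x*(a/e))"
    using nz by (simp add: field_simps power2_eq_square)
  have "(z - 1) * ((1 - a*x^2) * P) =
     z * (1 - x*e) * Q - (1 - x*a/e) * (1 - x*e*z) * P - (a/e) * R * x * (1 - x*e) * (1 - q*a*x^2)"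
  proof -
    have comb: "(z - 1) * (s * P) = z * g * Q - t * P - v * R * x * g * y"
      if "s * (z - 1) + t = g * u" "P * u - z * Q = - v * R * x * y" for s t g u v y :: complex
      using that by algebra
    show ?thesis
      by (rule comb[OF m k'])
  qed
  hence "(1 - a*x^2) * P =
     (z * (1 - x*e) * Q - (1 - x*a/e) * (1 - x*e*z) * P - (a/e) * R * x * (1 - x*e) * (1 - q*a*x^2)) / (z - 1)"
    using z(2) by (simp add: nonzero_eq_divide_eq mult.commute)
  also have "\<dots> = (z * (1 - x*e) * Q - (1 - x*a/e) * (1 - x*e*z) * P) / (z - 1) + (a/e) * R / (1 - z) * x * (1 - x*e) * (1 - q*a*x^2)"
  proof -
    have "u / (1 - z) = - u / (z - 1)" for u
      by (metis minus_diff_eq minus_divide_divide minus_minus)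
    thus ?thesis by (simp add: diff_divide_distrib)
  qed
  finally have *: "(1 - a*x^2) * P = \<dots>" .
  have Q: "z * (1 - x*b) * (1 - x*c) * (1 - x*d) * (1 - x*e) * (1 - q*x*e*z) = z * (1 - x*e) * Q"
    unfolding Q_def by (simp only: mult_ac)
  have R: "(a/e) * (1 - q*a/(b*c)) * (1 - q*a/(b*d)) * (1 - q*a/(c*d)) = (a/e) * R"
    unfolding R_def by (simp only: mult_ac)
  show ?thesis
    unfolding Q R by (rule *)
qed

lemma wp_summand_Suc:
  "wp_summand q a b c d e z (Suc k) = wp_summand q a b c d e z k * z
     * ((1 - q^k*b) * (1 - q^k*c) * (1 - q^k*d) * (1 - q^k*e)
       / ((1 - q^k*(q*a/b)) * (1 - q^k*(q*a/c)) * (1 - q^k*(q*a/d)) * (1 - q^k*(q*a/e))))"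
  by (simp add: wp_summand_def qpoch_Suc mult_ac)

text \<open>The denominators belonging to \<open>b\<close>, \<open>c\<close>, \<open>d\<close> and
  the numerator in \<open>e\<close> move by \<open>q\<close>, while
  \<open>q*(q*a)/(q*e) = q*a/e\<close> stays. Hence \<open>qpoch_shift\<close> turns the new summand
  into the old one times linear factors in \<open>q^k\<close>.\<close>

lemma wp_summand_contiguous:
  assumes "q \<noteq> 0"
    and nv: "\<And>k. qpoch (q*a/b) q k \<noteq> 0" "\<And>k. qpoch (q*a/c) q k \<noteq> 0" "\<And>k. qpoch (q*a/d) q k \<noteq> 0"
  shows "(1 - e) / ((1 - q*a/b) * (1 - q*a/c) * (1 - q*a/d)) * wp_summand q (q*a) b c d (q*e) (q*z) k
    = wp_summand q a b c d e z k * q^k * (1 - q^k*e)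
       / ((1 - q^k*(q*a/b)) * (1 - q^k*(q*a/c)) * (1 - q^k*(q*a/d)))"
proof -
  have sh: "(1 - y) * qpoch (q * y) q k = qpoch y q k * (1 - q ^ k * y)" for y
    by (rule qpoch_shift)
  have "q * (q * a) / b = q * (q*a/b)" "q * (q * a) / c = q * (q*a/c)" "q * (q * a) / d = q * (q*a/d)"
    by simp_all
  moreover have "q * (q * a) / (q * e) = q*a/e"
    using assms(1) by simp
  ultimately have "(1 - e) / ((1 - q*a/b) * (1 - q*a/c) * (1 - q*a/d)) * wp_summand q (q*a) b c d (q*e) (q*z) k
    = qpoch b q k * qpoch c q k * qpoch d q k * ((1 - e) * qpoch (q * e) q k) /
      (((1 - q*a/b) * qpoch (q * (q*a/b)) q k) * ((1 - q*a/c) * qpoch (q * (q*a/c)) q k)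
        * ((1 - q*a/d) * qpoch (q * (q*a/d)) q k) * qpoch (q*a/e) q k) * (q * z) ^ k"
    by (simp add: wp_summand_def mult_ac)
  also have "\<dots> = wp_summand q a b c d e z k * q^k * (1 - q^k*e)
       / ((1 - q^k*(q*a/b)) * (1 - q^k*(q*a/c)) * (1 - q^k*(q*a/d)))"
    unfolding sh by (simp add: wp_summand_def power_mult_distrib mult_ac)
  finally show ?thesis .
qed

lemma wp_telescope_step:
  fixes a b c d e q z :: complex
  assumes nz: "a \<noteq> 0" "b \<noteq> 0" "c \<noteq> 0" "d \<noteq> 0" "e \<noteq> 0" "q \<noteq> 0"
    and z: "b*c*d*e*z = q*a^2" "z \<noteq> 1"
    and nv: "\<And>k. qpoch (q*a/b) q k \<noteq> 0" "\<And>k. qpoch (q*a/c) q k \<noteq> 0"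
      "\<And>k. qpoch (q*a/d) q k \<noteq> 0" "\<And>k. qpoch (q*a/e) q k \<noteq> 0"
  defines "h \<equiv> \<lambda>k. wp_summand q a b c d e z k * (1 - q^k*a/e) * (1 - q^k*e*z) / (z - 1)"
    and "C \<equiv> (a/e) * (1 - e) * (1 - q*a/(b*c)) * (1 - q*a/(b*d)) * (1 - q*a/(c*d))
              / ((1 - z) * (1 - q*a/b) * (1 - q*a/c) * (1 - q*a/d))"
  shows "(1 - q^(2*k)*a) * wp_summand q a b c d e z k =
    h (Suc k) - h k + C * ((1 - q^(2*k)*(q*a)) * wp_summand q (q*a) b c d (q*e) (q*z) k)"
proof -
  define x where "x = q^k"
  define s where "s = wp_summand q a b c d e z k"
  define P where "P = (1 - x*(q*a/b)) * (1 - x*(q*a/c)) * (1 - x*(q*a/d))"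
  define E where "E = 1 - x*(q*a/e)"
  define R where "R = (a/e) * (1 - q*a/(b*c)) * (1 - q*a/(b*d)) * (1 - q*a/(c*d)) / (1 - z)"
  define N where "N = z * (1 - x*b) * (1 - x*c) * (1 - x*d) * (1 - x*e) * (1 - q*x*e*z)"
  have P: "P \<noteq> 0" and E: "E \<noteq> 0"
    using nv(1,2,3,4)[of "Suc k"] by (simp_all add: P_def E_def x_def qpoch_Suc)
  have key: "(1 - a*x^2) * P = (N - (1 - x*a/e) * (1 - x*e*z) * P) / (z - 1) + R * x * (1 - x*e) * (1 - q*a*x^2)"
    unfolding N_def R_def P_def by (rule wp_telescope_identity) (use nz z in auto)
  have h0: "h k = s * ((1 - x*a/e) * (1 - x*e*z)) / (z - 1)"
    by (simp add: h_def s_def x_def)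
  \<comment> \<open>The factor \<open>1 - q^Suc k*a/e\<close> of \<open>h (Suc k)\<close> is also
    the last new denominator factor of the next summand, so the two cancel.\<close>
  have E': "1 - q^Suc k*a/e = E"
    by (simp add: E_def x_def)
  have "h (Suc k) = s * z * ((1 - x*b) * (1 - x*c) * (1 - x*d) * (1 - x*e) / (P * E)) * E * (1 - q*x*e*z) / (z - 1)"
    unfolding h_def E' wp_summand_Suc s_def[symmetric] x_def[symmetric] P_def[symmetric] E_def[symmetric]
    by (simp add: x_def mult.assoc)
  also have "\<dots> = s * N / (P * (z - 1))"
    using E by (simp add: N_def mult_ac)
  finally have h1: "h (Suc k) = s * N / (P * (z - 1))" .
  have "C * wp_summand q (q*a) b c d (q*e) (q*z) k = R * ((1 - e) / ((1 - q*a/b) * (1 - q*a/c) * (1 - q*a/d)) * wp_summand q (q*a) b c d (q*e) (q*z) k)"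
    by (simp add: C_def R_def mult_ac)
  also have "\<dots> = R * (s * x * (1 - x*e) / P)"
    by (subst wp_summand_contiguous) (use nz nv in \<open>simp_all add: s_def x_def P_def\<close>)
  finally have u: "C * wp_summand q (q*a) b c d (q*e) (q*z) k = R * (s * x * (1 - x*e) / P)" .
  have x2: "q^(2*k)*a = a*x^2" "q^(2*k)*(q*a) = q*a*x^2"
    by (simp_all add: x_def power_even_eq)
  have "(1 - a*x^2) * s = s / P * ((1 - a*x^2) * P)"
    using P by simp
  also have "\<dots> = s * N / (P * (z - 1)) - s * ((1 - x*a/e) * (1 - x*e*z)) / (z - 1) + (1 - q*a*x^2) * (R * (s * x * (1 - x*e) / P))"
  proof -
    have "s / P * ((N - m * P) / y + R * x * g * t) = s * N / (P * y) - s * m / y + t * (R * (s * x * g / P))"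
      for m y g t :: complex
      using P by (simp add: diff_divide_distrib add_divide_distrib ring_distribs mult_ac)
    thus ?thesis unfolding key .
  qed
  finally show ?thesis
    unfolding x2 h0 h1 s_def[symmetric] u[symmetric] by (simp only: mult.left_commute)
qed

text \<open>Abel summation: \<open>wp_telescope_step\<close> is summed over \<open>k < n\<close>.
  The first term is the upper boundary, which disappears once the summand at \<open>n\<close>
  vanishes; the second is the lower boundary \<open>- h 0\<close>.\<close>

lemma wp_sum_contiguous:
  fixes a b c d e q z :: complex
  assumes nz: "a \<noteq> 0" "b \<noteq> 0" "c \<noteq> 0" "d \<noteq> 0" "e \<noteq> 0" "q \<noteq> 0"
    and z: "b*c*d*e*z = q*a^2" "z \<noteq> 1"
    and nv: "\<And>k. qpoch (q*a/b) q k \<noteq> 0" "\<And>k. qpoch (q*a/c) q k \<noteq> 0"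
      "\<And>k. qpoch (q*a/d) q k \<noteq> 0" "\<And>k. qpoch (q*a/e) q k \<noteq> 0"
  shows "wp_sum q a b c d e z n =
    wp_summand q a b c d e z n * (1 - q^n*a/e) * (1 - q^n*e*z) / (z - 1)
    + (1 - a/e) * (1 - e*z) / (1 - z)
    + (a/e) * (1 - e) * (1 - q*a/(b*c)) * (1 - q*a/(b*d)) * (1 - q*a/(c*d))
        / ((1 - z) * (1 - q*a/b) * (1 - q*a/c) * (1 - q*a/d)) * wp_sum q (q*a) b c d (q*e) (q*z) n"
proof -
  define h where "h = (\<lambda>k. wp_summand q a b c d e z k * (1 - q^k*a/e) * (1 - q^k*e*z) / (z - 1))"
  define C where "C = (a/e) * (1 - e) * (1 - q*a/(b*c)) * (1 - q*a/(b*d)) * (1 - q*a/(c*d))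
        / ((1 - z) * (1 - q*a/b) * (1 - q*a/c) * (1 - q*a/d))"
  have "wp_sum q a b c d e z n = (\<Sum>k<n. h (Suc k) - h k) + C * wp_sum q (q*a) b c d (q*e) (q*z) n"
    unfolding wp_sum_def sum_distrib_left sum.distrib[symmetric] h_def C_def
    by (intro sum.cong refl wp_telescope_step assms)
  also have "(\<Sum>k<n. h (Suc k) - h k) = h n - h 0"
    by (simp add: sum_lessThan_telescope)
  also have "- h 0 = (1 - a/e) * (1 - e*z) / (1 - z)"
    unfolding h_def by (simp add: wp_summand_def) (metis minus_diff_eq minus_divide_right)
  hence "h n - h 0 = h n + (1 - a/e) * (1 - e*z) / (1 - z)"
    by simp
  finally show ?thesis
    by (simp only: h_def C_def)
qed

lemma wp_sum_shift:
  assumes "q \<noteq> 0"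
  shows "wp_sum q a b c d e z (Suc n) = (1 - a) + z * (1 - b) * (1 - c) * (1 - d) * (1 - e)
    / ((1 - q*a/b) * (1 - q*a/c) * (1 - q*a/d) * (1 - q*a/e))
    * wp_sum q (q^2*a) (q*b) (q*c) (q*d) (q*e) z n"
proof -
  define F where "F = z * (1 - b) * (1 - c) * (1 - d) * (1 - e)
    / ((1 - q*a/b) * (1 - q*a/c) * (1 - q*a/d) * (1 - q*a/e))"
  have e: "q * (q^2*a) / (q * y) = q * (q*a/y)" for y
    using assms by (simp add: power2_eq_square)
  have s: "wp_summand q a b c d e z (Suc k) = F * wp_summand q (q^2*a) (q*b) (q*c) (q*d) (q*e) z k" for k
    unfolding wp_summand_def qpoch_Suc_head e F_def by (simp add: mult_ac)
  have x: "q ^ (2 * Suc k) * a = q^(2*k) * (q^2*a)" for k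
    by (simp add: power2_eq_square mult_ac)
  have "wp_sum q a b c d e z (Suc n) = (1 - a) + (\<Sum>k<n. (1 - q ^ (2 * Suc k) * a) * wp_summand q a b c d e z (Suc k))"
    unfolding wp_sum_def by (subst sum.lessThan_Suc_shift) (simp add: wp_summand_def)
  also have "\<dots> = (1 - a) + F * wp_sum q (q^2*a) (q*b) (q*c) (q*d) (q*e) z n"
    unfolding wp_sum_def sum_distrib_left s x by (simp only: mult.left_commute)
  finally show ?thesis
    by (simp only: F_def)
qed

section \<open>Evaluation of the sum with e = a\<close>

text \<open>The argument \<open>q^m*z\<close> tends to 0, so only the term \<open>k = 0\<close>
  survives. As \<open>e = a\<close> throughout, the denominator \<open>(q*a/e; q)\<^sub>k\<close> is
  the fixed nonzero \<open>(q; q)\<^sub>k\<close>; the other denominators tend to 1.\<close>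

lemma wp_sum_6phi5_tendsto:
  fixes a b c d q z :: complex
  assumes "0 < norm q" "norm q < 1" "a \<noteq> 0" "n > 0"
  shows "(\<lambda>m. wp_sum q (q^m*a) b c d (q^m*a) (q^m*z) n) \<longlonglongrightarrow> 1"
proof -
  have q0: "q \<noteq> 0" using assms by auto
  have u: "(\<lambda>m. q ^ m) \<longlonglongrightarrow> 0"
    using assms(2) by (rule LIMSEQ_power_zero)
  have s: "wp_summand q (q^m*a) b c d (q^m*a) (q^m*z) k =
      qpoch b q k * qpoch c q k * qpoch d q k * qpoch (q^m*a) q k
       / (qpoch (q*(q^m*a)/b) q k * qpoch (q*(q^m*a)/c) q k * qpoch (q*(q^m*a)/d) q k * qpoch q q k) * (q^m*z) ^ k" for m k
    using assms(3) q0 by (simp add: wp_summand_def)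
  have lim: "(\<lambda>m. (1 - q^(2*k) * (q^m*a)) * wp_summand q (q^m*a) b c d (q^m*a) (q^m*z) k)
      \<longlonglongrightarrow> (1 - q^(2*k) * (0*a)) * (qpoch b q k * qpoch c q k * qpoch d q k * qpoch (0*a) q k
       / (qpoch (q*(0*a)*inverse b) q k * qpoch (q*(0*a)*inverse c) q k * qpoch (q*(0*a)*inverse d) q k * qpoch q q k) * (0*z) ^ k)" for k
    unfolding s divide_inverse[of _ b] divide_inverse[of _ c] divide_inverse[of _ d]
    by (intro tendsto_intros tendsto_qpoch u)
       (use qpoch_nonzero_of_inf[OF assms(2) qpoch_inf_q_nonzero[OF assms(2)]] in simp)
  have "(\<lambda>m. (1 - q^(2*k) * (q^m*a)) * wp_summand q (q^m*a) b c d (q^m*a) (q^m*z) k)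
      \<longlonglongrightarrow> (if k = 0 then 1 else 0)" for k
    using lim[of k] by (cases "k = 0") (simp_all add: power_0_left)
  hence "(\<lambda>m. wp_sum q (q^m*a) b c d (q^m*a) (q^m*z) n) \<longlonglongrightarrow> (\<Sum>k<n. if k = 0 then 1 else 0)"
    unfolding wp_sum_def by (rule tendsto_sum)
  thus ?thesis
    using assms(4) by simp
qed

text \<open>The relation preserves \<open>e = a\<close>, since both are multiplied by
  \<open>q\<close>. At each step the lower boundary term contains \<open>1 - a/e = 0\<close>, and
  the upper one vanishes by \<open>fin\<close>.\<close>

lemma wp_sum_6phi5_iterate:
  fixes a b c d q z :: complex
  assumes q: "0 < norm q" "norm q < 1"
    and nz: "a \<noteq> 0" "b \<noteq> 0" "c \<noteq> 0" "d \<noteq> 0"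
    and z: "b*c*d*z = q*a"
    and nv: "qpoch_inf z q \<noteq> 0" "qpoch_inf (q*a/b) q \<noteq> 0" "qpoch_inf (q*a/c) q \<noteq> 0" "qpoch_inf (q*a/d) q \<noteq> 0"
    and fin: "qpoch b q n = 0"
  shows "wp_sum q a b c d a z n =
    qpoch a q m * qpoch (q*a/(b*c)) q m * qpoch (q*a/(b*d)) q m * qpoch (q*a/(c*d)) q m
      / (qpoch z q m * qpoch (q*a/b) q m * qpoch (q*a/c) q m * qpoch (q*a/d) q m)
      * wp_sum q (q^m*a) b c d (q^m*a) (q^m*z) n"
proof (induction m)
  case (Suc m)
  have q0: "q \<noteq> 0" using q by auto
  define \<alpha> where "\<alpha> = q^m*a"
  define \<zeta> where "\<zeta> = q^m*z"
  have \<alpha>0: "\<alpha> \<noteq> 0" using q0 nz by (simp add: \<alpha>_def)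
  have sh: "q * \<alpha> / y = q^m * (q*a/y)" for y
    by (simp add: \<alpha>_def)
  have nv': "qpoch (q^m * x) q k \<noteq> 0" if "qpoch_inf x q \<noteq> 0" for x k
    using qpoch_nonzero_of_inf[OF q(2) that, of "m + k"] by (simp add: qpoch_add)
  have nv'': "qpoch (q*\<alpha>/b) q k \<noteq> 0" "qpoch (q*\<alpha>/c) q k \<noteq> 0" "qpoch (q*\<alpha>/d) q k \<noteq> 0" for k
    unfolding sh by (rule nv'[OF nv(2)] nv'[OF nv(3)] nv'[OF nv(4)])+
  have "1 - \<zeta> \<noteq> 0"
    using nv'[OF nv(1), of 1] by (simp add: \<zeta>_def qpoch_Suc)
  moreover have "b*c*d*\<alpha>*\<zeta> = q*\<alpha>^2"
    using z by (simp add: \<alpha>_def \<zeta>_def power2_eq_square mult_ac)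
  moreover have "qpoch (q*\<alpha>/\<alpha>) q k \<noteq> 0" for k
    using \<alpha>0 qpoch_nonzero_of_inf[OF q(2) qpoch_inf_q_nonzero[OF q(2)]] by simp
  ultimately have "wp_sum q \<alpha> b c d \<alpha> \<zeta> n =
    wp_summand q \<alpha> b c d \<alpha> \<zeta> n * (1 - q^n*\<alpha>/\<alpha>) * (1 - q^n*\<alpha>*\<zeta>) / (\<zeta> - 1)
    + (1 - \<alpha>/\<alpha>) * (1 - \<alpha>*\<zeta>) / (1 - \<zeta>)
    + (\<alpha>/\<alpha>) * (1 - \<alpha>) * (1 - q*\<alpha>/(b*c)) * (1 - q*\<alpha>/(b*d)) * (1 - q*\<alpha>/(c*d))
        / ((1 - \<zeta>) * (1 - q*\<alpha>/b) * (1 - q*\<alpha>/c) * (1 - q*\<alpha>/d)) * wp_sum q (q*\<alpha>) b c d (q*\<alpha>) (q*\<zeta>) n"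
    by (intro wp_sum_contiguous) (use \<alpha>0 nz q0 nv'' in auto)
  also have "\<dots> = (1 - q^m*a) * (1 - q^m*(q*a/(b*c))) * (1 - q^m*(q*a/(b*d))) * (1 - q^m*(q*a/(c*d)))
        / ((1 - q^m*z) * (1 - q^m*(q*a/b)) * (1 - q^m*(q*a/c)) * (1 - q^m*(q*a/d)))
        * wp_sum q (q^Suc m*a) b c d (q^Suc m*a) (q^Suc m*z) n"
    unfolding sh using \<alpha>0 q0 fin by (simp add: wp_summand_def \<alpha>_def \<zeta>_def mult.assoc)
  finally have *: "wp_sum q (q^m*a) b c d (q^m*a) (q^m*z) n = \<dots>"
    by (simp only: \<alpha>_def \<zeta>_def)
  show ?case
    unfolding Suc.IH *
    by (simp only: qpoch_Suc times_divide_eq_left times_divide_eq_right divide_divide_eq_left mult_ac)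
qed simp

lemma wp_sum_6phi5:
  fixes a b c d q z :: complex
  assumes q: "0 < norm q" "norm q < 1"
    and nz: "a \<noteq> 0" "b \<noteq> 0" "c \<noteq> 0" "d \<noteq> 0"
    and z: "b*c*d*z = q*a"
    and nv: "qpoch_inf z q \<noteq> 0" "qpoch_inf (q*a/b) q \<noteq> 0" "qpoch_inf (q*a/c) q \<noteq> 0" "qpoch_inf (q*a/d) q \<noteq> 0"
    and fin: "qpoch b q n = 0"
  shows "wp_sum q a b c d a z n =
    qpoch_inf a q * qpoch_inf (q*a/(b*c)) q * qpoch_inf (q*a/(b*d)) q * qpoch_inf (q*a/(c*d)) q
      / (qpoch_inf z q * qpoch_inf (q*a/b) q * qpoch_inf (q*a/c) q * qpoch_inf (q*a/d) q)"
proof -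
  have n: "n > 0" using fin by (cases n) auto
  \<comment> \<open>By \<open>wp_sum_6phi5_iterate\<close> this sequence is constant in
    \<open>m\<close>, so its limit is the sum itself.\<close>
  have "(\<lambda>m. qpoch a q m * qpoch (q*a/(b*c)) q m * qpoch (q*a/(b*d)) q m * qpoch (q*a/(c*d)) q m
      / (qpoch z q m * qpoch (q*a/b) q m * qpoch (q*a/c) q m * qpoch (q*a/d) q m)
      * wp_sum q (q^m*a) b c d (q^m*a) (q^m*z) n) \<longlonglongrightarrow>
    qpoch_inf a q * qpoch_inf (q*a/(b*c)) q * qpoch_inf (q*a/(b*d)) q * qpoch_inf (q*a/(c*d)) q
      / (qpoch_inf z q * qpoch_inf (q*a/b) q * qpoch_inf (q*a/c) q * qpoch_inf (q*a/d) q) * 1"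
    by (intro tendsto_mult tendsto_divide qpoch_tendsto wp_sum_6phi5_tendsto q nz(1) n) (use nv in simp)
  thus ?thesis
    unfolding wp_sum_6phi5_iterate[OF assms, symmetric] by (simp add: LIMSEQ_const_iff)
qed

section \<open>The terminating case\<close>

lemma wp_sum_swap: "wp_sum q a b c d e z n = wp_sum q a b c e d z n"
  by (simp add: wp_sum_def wp_summand_def mult_ac)

text \<open>The sum after \<open>m\<close> rounds is obtained for \<open>Q = q\<^sup>m\<close>, \<open>w = a\<close> and \<open>\<kappa> = c/a\<close>. The three factors
  below come from dropping the first summand and from the relations for \<open>e = cd/a\<close> and \<open>e = bd/a\<close>.\<close>

definition stage_sum ::
  "complex \<Rightarrow> complex \<Rightarrow> complex \<Rightarrow> complex \<Rightarrow> complex \<Rightarrow> complex \<Rightarrow> nat \<Rightarrow> complex" where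
  "stage_sum q b d \<kappa> w Q n =
     wp_sum q (Q^4*d) (Q*d) (Q*(q/(b*\<kappa>))) (Q^2*(b*d/w)) (Q^2*(\<kappa>*d)) (Q^2*(w/d)) n"

definition shift_factor where
  "shift_factor q b d \<kappa> w Q = Q^2 * (w/d) * (1 - Q*d) * (1 - Q*(q/(b*\<kappa>))) * (1 - Q^2*(b*d/w)) * (1 - Q^2*(\<kappa>*d))
     / ((1 - Q^3*q) * (1 - Q^3*(b*d*\<kappa>)) * (1 - Q^2*(q*w/b)) * (1 - Q^2*(q/\<kappa>)))"

definition cd_factor where
  "cd_factor q b d \<kappa> w Q = Q^2*(q/\<kappa>) * (1 - q*Q^2*(\<kappa>*d)) * (1 - Q^2*(b*\<kappa>)) * (1 - Q*(q*w/(b*d))) * (1 - Q*(\<kappa>*w))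
     / ((1 - Q^2*(w/d)) * (1 - q*Q^3*q) * (1 - q*Q^3*(b*d*\<kappa>)) * (1 - q*Q^2*(q*w/b)))"

definition bd_factor where
  "bd_factor q b d \<kappa> w Q = q*Q^2*(q*w/b) * (1 - q*Q^2*(b*d/w)) * (1 - q*Q^2*(b*\<kappa>)) * (1 - Q*(q/(\<kappa>*d))) * (1 - Q*b)
     / ((1 - q*Q^2*(w/d)) * (1 - q^2*Q^3*q) * (1 - q^2*Q^3*(b*d*\<kappa>)) * (1 - q*Q^2*(q/\<kappa>)))"

text \<open>One round: \<open>wp_sum_shift\<close> removes the term \<open>k = 0\<close>, at the
  cost of one summand; then \<open>wp_sum_contiguous\<close> is applied with the parameters
  containing \<open>\<kappa>*d\<close> and \<open>b*d/w\<close> in turn as \<open>e\<close>. These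
  two have then gained \<open>q^2\<close> and the other numerator parameters \<open>q\<close>, which
  amounts to replacing \<open>Q\<close> by \<open>q*Q\<close>.\<close>

lemma stage_sum_Suc:
  fixes q b d \<kappa> w Q :: complex
  assumes nz: "q \<noteq> 0" "b \<noteq> 0" "d \<noteq> 0" "\<kappa> \<noteq> 0" "w \<noteq> 0" "Q \<noteq> 0"
    and nv: "\<And>k. qpoch (Q^3*q) q k \<noteq> 0" "\<And>k. qpoch (Q^3*(b*d*\<kappa>)) q k \<noteq> 0"
      "\<And>k. qpoch (Q^2*(q*w/b)) q k \<noteq> 0" "\<And>k. qpoch (Q^2*(q/\<kappa>)) q k \<noteq> 0"
      "\<And>k. qpoch (Q^2*(w/d)) q k \<noteq> 0"
    and fin: "qpoch (Q^2*(b*d/w)) q (Suc n) = 0"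
  shows "stage_sum q b d \<kappa> w Q (Suc n) = 1 - Q^4*d + shift_factor q b d \<kappa> w Q *
     ((1 - Q^2*(q/\<kappa>)) * (1 - q*Q^4*(\<kappa>*w)) / (1 - Q^2*(w/d)) + cd_factor q b d \<kappa> w Q *
       ((1 - q*Q^2*(q*w/b)) * (1 - q^2*Q^4*b) / (1 - q*Q^2*(w/d))
         + bd_factor q b d \<kappa> w Q * stage_sum q b d \<kappa> w (q*Q) n))"
\<comment> \<open>In this case \<open>shift_factor\<close> is zero and only the term
  \<open>k = 0\<close> remains. Otherwise the factor that ends the sum is not the first one, so it
  survives the shift as \<open>fin'\<close>.\<close>
proof (cases "Q^2*(b*d/w) = 1")
  case True
  then show ?thesis
    using wp_sum_shift[OF nz(1)] by (simp add: stage_sum_def shift_factor_def)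
next
  case False
  \<comment> \<open>These are the parameters left by \<open>wp_sum_shift\<close>.\<close>
  define \<beta> \<gamma> \<delta> \<epsilon> z where defs: "\<beta> = q*(Q*d)" "\<gamma> = q*(Q^2*(b*d/w))" "\<delta> = q*(Q^2*(\<kappa>*d))"
    "\<epsilon> = q*(Q*(q/(b*\<kappa>)))" "z = Q^2*(w/d)"
  define \<alpha> where "\<alpha> = q^2*(Q^4*d)"
  note defs = defs \<alpha>_def
  have nz': "\<alpha> \<noteq> 0" "\<beta> \<noteq> 0" "\<gamma> \<noteq> 0" "\<delta> \<noteq> 0" "\<epsilon> \<noteq> 0" "z \<noteq> 0"
    using nz by (simp_all add: defs)
  have fin': "qpoch \<gamma> q n = 0"
    using fin False unfolding defs by (metis qpoch_Suc_head mult_eq_0_iff right_minus_eq)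
  have Q4: "Q^4 = Q*Q*Q*Q" and Q3: "Q^3 = Q*Q*Q"
    by (simp_all add: eval_nat_numeral)
  have r: "q*\<alpha>/\<beta> = q*(Q^3*q)" "q*\<alpha>/\<gamma> = q*(Q^2*(q*w/b))" "q*\<alpha>/\<delta> = q*(Q^2*(q/\<kappa>))" "q*\<alpha>/\<epsilon> = q*(Q^3*(b*d*\<kappa>))"
    "q*(q*\<alpha>)/\<beta> = q*(q*(Q^3*q))" "q*(q*\<alpha>)/\<gamma> = q*(q*(Q^2*(q*w/b)))" "q*(q*\<alpha>)/(q*\<delta>) = q*(Q^2*(q/\<kappa>))" "q*(q*\<alpha>)/\<epsilon> = q*(q*(Q^3*(b*d*\<kappa>)))"
    "\<alpha>/\<delta> = Q^2*(q/\<kappa>)" "q*\<alpha>/\<gamma> = q*Q^2*(q*w/b)"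
    "q*\<alpha>/(\<beta>*\<epsilon>) = Q^2*(b*\<kappa>)" "q*\<alpha>/(\<beta>*\<gamma>) = Q*(q*w/(b*d))" "q*\<alpha>/(\<epsilon>*\<gamma>) = Q*(\<kappa>*w)"
    "q*(q*\<alpha>)/(\<beta>*\<epsilon>) = q*Q^2*(b*\<kappa>)" "q*(q*\<alpha>)/(\<beta>*(q*\<delta>)) = Q*(q/(\<kappa>*d))" "q*(q*\<alpha>)/(\<epsilon>*(q*\<delta>)) = Q*b"
    "\<delta>*z = q*Q^4*(\<kappa>*w)" "\<gamma>*(q*z) = q^2*Q^4*b"
    using nz by (simp_all add: defs Q4 Q3 power2_eq_square field_simps)
  have nvh: "qpoch (q*x) q k \<noteq> 0" if "\<And>k. qpoch x q k \<noteq> 0" for x k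
    using that[of "Suc k"] by (simp add: qpoch_Suc_head)
  have bal: "\<beta>*\<epsilon>*\<gamma>*\<delta>*z = q*\<alpha>^2" "\<beta>*\<epsilon>*(q*\<delta>)*\<gamma>*(q*z) = q*(q*\<alpha>)^2"
    using nz by (simp_all add: defs Q4 power2_eq_square field_simps)
  have z1: "z \<noteq> 1" "q*z \<noteq> 1"
    using nv(5)[of 1] nvh[OF nv(5), of 1] by (auto simp: qpoch_Suc defs)
  have s1: "wp_sum q \<alpha> \<beta> \<epsilon> \<gamma> \<delta> z n = (1 - Q^2*(q/\<kappa>)) * (1 - q*Q^4*(\<kappa>*w)) / (1 - z) +
     Q^2*(q/\<kappa>) * (1 - \<delta>) * (1 - Q^2*(b*\<kappa>)) * (1 - Q*(q*w/(b*d))) * (1 - Q*(\<kappa>*w))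
     / ((1 - z) * (1 - q*(Q^3*q)) * (1 - q*(Q^3*(b*d*\<kappa>))) * (1 - q*(Q^2*(q*w/b))))
     * wp_sum q (q*\<alpha>) \<beta> \<epsilon> \<gamma> (q*\<delta>) (q*z) n"
    by (subst wp_sum_contiguous[OF nz'(1,2,5,3,4) nz(1) bal(1) z1(1)])
       (unfold r, (rule nvh nv)+, simp add: wp_summand_def fin')
  \<comment> \<open>The second relation moves \<open>\<gamma>\<close>, which therefore takes the
    place of \<open>e\<close>; the sum still terminates through it.\<close>
  have s2: "wp_sum q (q*\<alpha>) \<beta> \<epsilon> (q*\<delta>) \<gamma> (q*z) n = (1 - q*Q^2*(q*w/b)) * (1 - q^2*Q^4*b) / (1 - q*z) +
     q*Q^2*(q*w/b) * (1 - \<gamma>) * (1 - q*Q^2*(b*\<kappa>)) * (1 - Q*(q/(\<kappa>*d))) * (1 - Q*b)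
     / ((1 - q*z) * (1 - q*(q*(Q^3*q))) * (1 - q*(q*(Q^3*(b*d*\<kappa>)))) * (1 - q*(Q^2*(q/\<kappa>))))
     * wp_sum q (q*(q*\<alpha>)) \<beta> \<epsilon> (q*\<delta>) (q*\<gamma>) (q*(q*z)) n"
    by (subst wp_sum_contiguous[OF _ nz'(2,5) _ nz'(3) nz(1) bal(2) z1(2)])
       (use nz nz' in simp, use nz nz' in simp, unfold r, (rule nvh nv)+, simp add: wp_summand_def fin' r mult.assoc)
  have s3: "wp_sum q (q*(q*\<alpha>)) \<beta> \<epsilon> (q*\<delta>) (q*\<gamma>) (q*(q*z)) n = stage_sum q b d \<kappa> w (q*Q) n"
    unfolding stage_sum_def by (subst wp_sum_swap) (simp add: defs power_mult_distrib eval_nat_numeral mult_ac)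
  have "stage_sum q b d \<kappa> w Q (Suc n) = 1 - Q^4*d + shift_factor q b d \<kappa> w Q * wp_sum q \<alpha> \<beta> \<epsilon> \<gamma> \<delta> z n"
  proof -
    have "q*(Q^4*d)/(Q*d) = Q^3*q" "q*(Q^4*d)/(Q*(q/(b*\<kappa>))) = Q^3*(b*d*\<kappa>)"
      "q*(Q^4*d)/(Q^2*(b*d/w)) = Q^2*(q*w/b)" "q*(Q^4*d)/(Q^2*(\<kappa>*d)) = Q^2*(q/\<kappa>)"
      using nz by (simp_all add: Q4 Q3 power2_eq_square field_simps)
    thus ?thesis
      unfolding stage_sum_def wp_sum_shift[OF nz(1)] shift_factor_def by (simp only: defs)
  qed
  thus ?thesis
    unfolding s1 wp_sum_swap[of q "q*\<alpha>" \<beta> \<epsilon> \<gamma>] s2 s3 cd_factor_def bd_factor_def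
    by (simp add: defs power2_eq_square mult.assoc)
qed

section \<open>Clearing denominators\<close>

text \<open>Here and in \<open>bd_num\<close> the factor \<open>w\<close> is absorbed into
  \<open>1 - Q^2*(b*d/w)\<close> or its successor, so that the numerators are polynomial in
  \<open>w\<close> and remain meaningful at \<open>w = 0\<close>, the accumulation point used
  later.\<close>

definition shift_num where
  "shift_num q b d \<kappa> w Q = Q^2 * (w - Q^2*(b*d)) / d * (1 - Q*d) * (1 - Q*(q/(b*\<kappa>))) * (1 - Q^2*(\<kappa>*d))"

definition cd_num where
  "cd_num q b d \<kappa> w Q = Q^2*(q/\<kappa>) * (1 - q*Q^2*(\<kappa>*d)) * (1 - Q^2*(b*\<kappa>)) * (1 - Q*(q*w/(b*d))) * (1 - Q*(\<kappa>*w))"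

definition bd_num where
  "bd_num q b d \<kappa> w Q = q*Q^2*(q/b) * (w - q*Q^2*(b*d)) * (1 - q*Q^2*(b*\<kappa>)) * (1 - Q*(q/(\<kappa>*d))) * (1 - Q*b)"

text \<open>The product over \<open>j\<close> is \<open>w\<^sup>2\<^sup>m (bd/w; q)\<^sub>2\<^sub>m\<close>, written so as to be polynomial in \<open>w\<close>.\<close>

definition coeff_num :: "complex \<Rightarrow> complex \<Rightarrow> complex \<Rightarrow> complex \<Rightarrow> complex \<Rightarrow> nat \<Rightarrow> complex" where
  "coeff_num q b d \<kappa> w m = q^(3*m^2) * (1/(b*d*\<kappa>))^m * (\<Prod>j<2*m. w - q^j*(b*d))
     * (qpoch d q m * qpoch (\<kappa>*d) q (2*m) * qpoch (q/(b*\<kappa>)) q m * qpoch (q*w/(b*d)) q m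
     * qpoch (b*\<kappa>) q (2*m) * qpoch (\<kappa>*w) q m * qpoch (q/(\<kappa>*d)) q m * qpoch b q m)"

text \<open>Four separate lengths are kept because the three terms of a round involve different
  numbers of denominator factors.\<close>

definition coeff_den where
  "coeff_den q b d \<kappa> w i j k l = qpoch q q i * qpoch (q*w/b) q j * qpoch (q/\<kappa>) q k
     * qpoch (b*d*\<kappa>) q i * qpoch (w/d) q l"

text \<open>The factors by which the denominators \<open>coeff_den\<close> miss the full infinite products.\<close>

definition coeff_tail where
  "coeff_tail q b d \<kappa> w i j k l = qpoch_inf (q^i*q) q * qpoch_inf (q^j*(q*w/b)) q
     * qpoch_inf (q^k*(q/\<kappa>)) q * qpoch_inf (q^i*(b*d*\<kappa>)) q * qpoch_inf (q^l*(w/d)) q"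

text \<open>The two boundary terms of round \<open>m\<close> and the term \<open>k = 0\<close> of
  the next round, times the full infinite products. With \<open>Q = q^m\<close>, the factor
  \<open>1 - Q^2*(q/\<kappa>)\<close> has been cancelled in the first and
  \<open>1 - q*Q^2*(q*w/b)\<close> in the second, hence the third length \<open>2*m\<close> in the
  first tail and the second length \<open>2*m+1\<close> in the second.\<close>

definition cleared_term where
  "cleared_term q b d \<kappa> w m =
     coeff_num q b d \<kappa> w m * shift_num q b d \<kappa> w (q^m) *
       ((1 - q*(q^m)^4*(\<kappa>*w)) * coeff_tail q b d \<kappa> w (3*m+1) (2*m+1) (2*m) (2*m+1)
        + cd_num q b d \<kappa> w (q^m) * (1 - q^2*(q^m)^4*b) * coeff_tail q b d \<kappa> w (3*m+2) (2*m+1) (2*m+1) (2*m+2))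
     + coeff_num q b d \<kappa> w (Suc m) * (1 - (q^Suc m)^4*d) * coeff_tail q b d \<kappa> w (3*Suc m) (2*Suc m) (2*Suc m) (2*Suc m)"

lemma coeff_den_coeff_tail:
  assumes "norm q < 1"
  shows "coeff_den q b d \<kappa> w i j k l * coeff_tail q b d \<kappa> w i j k l = coeff_tail q b d \<kappa> w 0 0 0 0"
proof -
  note s = qpoch_inf_split[OF assms]
  show ?thesis
    unfolding coeff_tail_def coeff_den_def power_0 mult_1_left
    unfolding s[of q i] s[of "q*w/b" j] s[of "q/\<kappa>" k] s[of "b*d*\<kappa>" i] s[of "w/d" l]
    by (simp only: mult_ac)
qed

lemma coeff_num_Suc:
  assumes "q \<noteq> 0" "b \<noteq> 0" "d \<noteq> 0" "\<kappa> \<noteq> 0"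
  shows "coeff_num q b d \<kappa> w (Suc m) = coeff_num q b d \<kappa> w m
     * (shift_num q b d \<kappa> w (q^m) * cd_num q b d \<kappa> w (q^m) * bd_num q b d \<kappa> w (q^m))"
proof -
  define Q where "Q = q^m"
  have Q2: "q^(2*m) = Q^2" "q^Suc (2*m) = q*Q^2"
    by (simp_all add: Q_def power_even_eq)
  have m2: "2 * Suc m = Suc (Suc (2*m))" by simp
  \<comment> \<open>The increment \<open>6*m + 3\<close> of the exponent matches the power
    \<open>Q^6 * q^3\<close> contributed by the three numerators.\<close>
  have sq: "3 * (Suc m)^2 = 3*m^2 + (m*6 + 3)"
    by (simp add: power2_eq_square)
  have pw: "q^(3 * (Suc m)^2) = q^(3*m^2) * (Q^6 * q^3)"
    unfolding sq power_add Q_def power_mult by (rule refl)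
  define T where "T = qpoch d q m * qpoch (\<kappa>*d) q (2*m) * qpoch (q/(b*\<kappa>)) q m * qpoch (q*w/(b*d)) q m
     * qpoch (b*\<kappa>) q (2*m) * qpoch (\<kappa>*w) q m * qpoch (q/(\<kappa>*d)) q m * qpoch b q m"
  define S where "S = (1 - Q*d) * ((1 - Q^2*(\<kappa>*d)) * (1 - q*Q^2*(\<kappa>*d))) * (1 - Q*(q/(b*\<kappa>))) * (1 - Q*(q*w/(b*d)))
     * ((1 - Q^2*(b*\<kappa>)) * (1 - q*Q^2*(b*\<kappa>))) * (1 - Q*(\<kappa>*w)) * (1 - Q*(q/(\<kappa>*d))) * (1 - Q*b)"
  define V where "V = (\<Prod>j<2*m. w - q^j*(b*d))"
  have T: "qpoch d q (Suc m) * qpoch (\<kappa>*d) q (2*Suc m) * qpoch (q/(b*\<kappa>)) q (Suc m) * qpoch (q*w/(b*d)) q (Suc m)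
     * qpoch (b*\<kappa>) q (2*Suc m) * qpoch (\<kappa>*w) q (Suc m) * qpoch (q/(\<kappa>*d)) q (Suc m) * qpoch b q (Suc m) = T * S"
    unfolding m2 qpoch_Suc T_def S_def Q2 Q_def[symmetric] by (simp only: mult_ac)
  have V: "(\<Prod>j<2*Suc m. w - q^j*(b*d)) = V * (w - Q^2*(b*d)) * (w - q*Q^2*(b*d))"
    unfolding m2 V_def prod.lessThan_Suc Q2 by (rule refl)
  have "Q^6 * q^3 * (1/(b*d*\<kappa>)) = Q^2/d * (Q^2*(q/\<kappa>)) * (q*Q^2*(q/b))"
    using assms by (simp add: field_simps eval_nat_numeral)
  moreover have "shift_num q b d \<kappa> w Q * cd_num q b d \<kappa> w Q * bd_num q b d \<kappa> w Q
     = Q^2/d * (Q^2*(q/\<kappa>)) * (q*Q^2*(q/b)) * ((w - Q^2*(b*d)) * (w - q*Q^2*(b*d))) * S"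
    unfolding shift_num_def cd_num_def bd_num_def S_def times_divide_eq_left[symmetric] by (simp only: mult_ac times_divide_eq_left times_divide_eq_right)
  ultimately have l: "shift_num q b d \<kappa> w Q * cd_num q b d \<kappa> w Q * bd_num q b d \<kappa> w Q
     = Q^6 * q^3 * (1/(b*d*\<kappa>)) * ((w - Q^2*(b*d)) * (w - q*Q^2*(b*d))) * S"
    by simp
  show ?thesis
    unfolding Q_def[symmetric] l
    unfolding coeff_num_def T V pw T_def[symmetric] V_def[symmetric] power_Suc by (simp only: mult_ac)
qed

text \<open>\<open>C m\<close> is the product of the factors of the first \<open>m\<close> rounds.
  By \<open>coeff_den_coeff_tail\<close> each tail is the full product divided by the finite
  denominator, so the cleared terms are the terms of the expansion times the full product.\<close>

lemma cleared_term_stage: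
  fixes q b d \<kappa> w :: complex and m :: nat
  assumes q: "norm q < 1" and nz: "q \<noteq> 0" "b \<noteq> 0" "d \<noteq> 0" "\<kappa> \<noteq> 0" "w \<noteq> 0"
    and nv: "\<And>i j k l. coeff_den q b d \<kappa> w i j k l \<noteq> 0"
  defines "C \<equiv> \<lambda>m. coeff_num q b d \<kappa> w m / coeff_den q b d \<kappa> w (3*m) (2*m) (2*m) (2*m)"
    and "Q \<equiv> q^m"
  shows "C (Suc m) = C m * shift_factor q b d \<kappa> w Q * cd_factor q b d \<kappa> w Q * bd_factor q b d \<kappa> w Q"
    and "cleared_term q b d \<kappa> w m = coeff_tail q b d \<kappa> w 0 0 0 0 * (C m * shift_factor q b d \<kappa> w Q *
     ((1 - Q^2*(q/\<kappa>)) * (1 - q*Q^4*(\<kappa>*w)) / (1 - Q^2*(w/d)) + cd_factor q b d \<kappa> w Q *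
       ((1 - q*Q^2*(q*w/b)) * (1 - q^2*Q^4*b) / (1 - q*Q^2*(w/d)))) + C (Suc m) * (1 - (q*Q)^4*d))"
proof -
  define N where "N = coeff_num q b d \<kappa> w m"
  define D where "D = coeff_den q b d \<kappa> w (3*m) (2*m) (2*m) (2*m)"
  have e: "3*Suc m = Suc (Suc (Suc (3*m)))" "2*Suc m = Suc (Suc (2*m))" "3*m+1 = Suc (3*m)" "2*m+1 = Suc (2*m)"
    "3*m+2 = Suc (Suc (3*m))" "2*m+2 = Suc (Suc (2*m))"
    by simp_all
  have Q23: "q^(2*m) = Q^2" "q^(3*m) = Q^3"
    by (simp_all only: Q_def power_mult[symmetric] mult.commute)
  hence Qp: "q^Suc (2*m) = q*Q^2" "q^Suc (3*m) = q*Q^3" "q^Suc (Suc (3*m)) = q^2*Q^3"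
    by (simp_all add: power2_eq_square)
  define u1 u2 u3 where u: "u1 = 1 - Q^3*q" "u2 = 1 - q*Q^3*q" "u3 = 1 - q^2*Q^3*q"
  define p1 p2 p3 where p: "p1 = 1 - Q^3*(b*d*\<kappa>)" "p2 = 1 - q*Q^3*(b*d*\<kappa>)" "p3 = 1 - q^2*Q^3*(b*d*\<kappa>)"
  define x1 x2 where x: "x1 = 1 - Q^2*(q*w/b)" "x2 = 1 - q*Q^2*(q*w/b)"
  define y1 y2 where y: "y1 = 1 - Q^2*(q/\<kappa>)" "y2 = 1 - q*Q^2*(q/\<kappa>)"
  define t1 t2 where t: "t1 = 1 - Q^2*(w/d)" "t2 = 1 - q*Q^2*(w/d)"
  note uv = u p x y t
  define L1 L2 L3 where L: "L1 = shift_num q b d \<kappa> w Q" "L2 = cd_num q b d \<kappa> w Q" "L3 = bd_num q b d \<kappa> w Q"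
  define E1 E2 E3 where E: "E1 = 1 - q*Q^4*(\<kappa>*w)" "E2 = 1 - q^2*Q^4*b" "E3 = 1 - (q*Q)^4*d"
  define W0 where "W0 = coeff_tail q b d \<kappa> w 0 0 0 0"
  have D3: "coeff_den q b d \<kappa> w (3*Suc m) (2*Suc m) (2*Suc m) (2*Suc m) = D*(u1*u2*u3*p1*p2*p3*x1*x2*y1*y2*t1*t2)"
    and D1: "coeff_den q b d \<kappa> w (3*m+1) (2*m+1) (2*m) (2*m+1) = D*(u1*p1*x1*t1)"
    and D2: "coeff_den q b d \<kappa> w (3*m+2) (2*m+1) (2*m+1) (2*m+2) = D*(u1*u2*p1*p2*x1*y1*t1*t2)"
    unfolding coeff_den_def D_def e qpoch_Suc Q23 Qp uv by (simp_all only: mult_ac)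
  have nz': "D \<noteq> 0" "u1 \<noteq> 0" "u2 \<noteq> 0" "u3 \<noteq> 0" "p1 \<noteq> 0" "p2 \<noteq> 0" "p3 \<noteq> 0" "x1 \<noteq> 0" "x2 \<noteq> 0"
    "y1 \<noteq> 0" "y2 \<noteq> 0" "t1 \<noteq> 0" "t2 \<noteq> 0"
    using nv[of "3*Suc m" "2*Suc m" "2*Suc m" "2*Suc m"] unfolding D3 by auto
  have tl: "coeff_tail q b d \<kappa> w i j k l = W0 / coeff_den q b d \<kappa> w i j k l" for i j k l
    unfolding W0_def coeff_den_coeff_tail[OF q, of b d \<kappa> w i j k l, symmetric] using nv by simp
  have "shift_factor q b d \<kappa> w Q = (Q^2*(w/d) * (1 - Q^2*(b*d/w))) * (1 - Q*d) * (1 - Q*(q/(b*\<kappa>))) * (1 - Q^2*(\<kappa>*d))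
      / (u1*p1*x1*y1)"
    unfolding shift_factor_def uv by (simp only: mult_ac)
  also have "Q^2*(w/d) * (1 - Q^2*(b*d/w)) = Q^2 * (w - Q^2*(b*d)) / d"
    using nz(3,5) by (simp add: right_diff_distrib diff_divide_distrib)
  finally have F: "shift_factor q b d \<kappa> w Q = L1 / (u1*p1*x1*y1)"
    unfolding L shift_num_def .
  have G: "cd_factor q b d \<kappa> w Q = L2 / (t1*u2*p2*x2)"
    unfolding cd_factor_def L cd_num_def uv by (simp only: mult_ac)
  have "q*Q^2*(q*w/b) * (1 - q*Q^2*(b*d/w)) = q*Q^2*(q/b) * (w - q*Q^2*(b*d))"
    using nz(5) by (simp add: right_diff_distrib)
  hence H: "bd_factor q b d \<kappa> w Q = L3 / (t2*u3*p3*y2)"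
    unfolding bd_factor_def L bd_num_def uv by (simp only:)
  have N': "coeff_num q b d \<kappa> w (Suc m) = N * (L1 * L2 * L3)"
    unfolding N_def L Q_def by (rule coeff_num_Suc) (use nz in auto)
  have Cm: "C m = N / D"
    by (simp add: C_def N_def D_def)
  have CS: "C (Suc m) = N * (L1 * L2 * L3) / (D*(u1*u2*u3*p1*p2*p3*x1*x2*y1*y2*t1*t2))"
    unfolding C_def N' D3 by (rule refl)
  show "C (Suc m) = C m * shift_factor q b d \<kappa> w Q * cd_factor q b d \<kappa> w Q * bd_factor q b d \<kappa> w Q"
    unfolding CS Cm F G H by (simp add: mult_ac)
  have "cleared_term q b d \<kappa> w m = N * L1 * (E1 * (W0 / (D*(u1*p1*x1*t1))) + L2 * E2 * (W0 / (D*(u1*u2*p1*p2*x1*y1*t1*t2))))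
     + N * (L1 * L2 * L3) * E3 * (W0 / (D*(u1*u2*u3*p1*p2*p3*x1*x2*y1*y2*t1*t2)))"
    unfolding cleared_term_def N' tl D1 D2 D3 unfolding N_def L E Q_def power_Suc by (rule refl)
  also have "\<dots> = W0 * (N / D * (L1 / (u1*p1*x1*y1)) * (y1 * E1 / t1 + L2 / (t1*u2*p2*x2) * (x2 * E2 / t2))
     + N * (L1 * L2 * L3) / (D*(u1*u2*u3*p1*p2*p3*x1*x2*y1*y2*t1*t2)) * E3)"
  proof -
    have a: "N * L1 * (E1 * (W0 / (D*(u1*p1*x1*t1)))) = W0 * (N / D * (L1 / (u1*p1*x1*y1)) * (y1 * E1 / t1))"
      using nz' by (simp add: mult_ac)
    have b: "N * L1 * (L2 * E2 * (W0 / (D*(u1*u2*p1*p2*x1*y1*t1*t2))))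
        = W0 * (N / D * (L1 / (u1*p1*x1*y1)) * (L2 / (t1*u2*p2*x2) * (x2 * E2 / t2)))"
      using nz' by (simp add: mult_ac)
    show ?thesis
      unfolding distrib_left a b by (simp add: mult_ac)
  qed
  finally show "cleared_term q b d \<kappa> w m = coeff_tail q b d \<kappa> w 0 0 0 0 * (C m * shift_factor q b d \<kappa> w Q *
     ((1 - Q^2*(q/\<kappa>)) * (1 - q*Q^4*(\<kappa>*w)) / (1 - Q^2*(w/d)) + cd_factor q b d \<kappa> w Q *
       ((1 - q*Q^2*(q*w/b)) * (1 - q^2*Q^4*b) / (1 - q*Q^2*(w/d)))) + C (Suc m) * (1 - (q*Q)^4*d))"
    unfolding CS Cm F G E uv W0_def .
qed

lemma coeff_num_0 [simp]: "coeff_num q b d \<kappa> w 0 = 1"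
  by (simp add: coeff_num_def)

lemma coeff_den_0 [simp]: "coeff_den q b d \<kappa> w 0 0 0 0 = 1"
  by (simp add: coeff_den_def)

lemma coeff_den_nonzero:
  assumes "norm q < 1" and "coeff_tail q b d \<kappa> w 0 0 0 0 \<noteq> 0"
  shows "coeff_den q b d \<kappa> w i j k l \<noteq> 0"
  using coeff_den_coeff_tail[OF assms(1), of b d \<kappa> w i j k l] assms(2) by auto

section \<open>Iterating the rounds\<close>

text \<open>Induction on the number of rounds, each of which uses up one of the \<open>n + m\<close>
  summands. In the remainder the term \<open>k = 0\<close> is subtracted because it is already
  counted, in \<open>1 - d\<close> or in the last cleared term.\<close>

lemma stage_sum_expand:
  fixes q b d \<kappa> w :: complex
  assumes q: "norm q < 1" and nz: "q \<noteq> 0" "b \<noteq> 0" "d \<noteq> 0" "\<kappa> \<noteq> 0" "w \<noteq> 0"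
    and D: "coeff_tail q b d \<kappa> w 0 0 0 0 \<noteq> 0"
    and fin: "qpoch (b*d/w) q n = 0"
  defines "C \<equiv> \<lambda>m. coeff_num q b d \<kappa> w m / coeff_den q b d \<kappa> w (3*m) (2*m) (2*m) (2*m)"
  shows "coeff_tail q b d \<kappa> w 0 0 0 0 * stage_sum q b d \<kappa> w 1 (n + m) =
    coeff_tail q b d \<kappa> w 0 0 0 0 * (1 - d) + (\<Sum>i<m. cleared_term q b d \<kappa> w i)
    + coeff_tail q b d \<kappa> w 0 0 0 0 * (C m * (stage_sum q b d \<kappa> w (q^m) n - (1 - (q^m)^4*d)))"
  using fin
proof (induction m arbitrary: n)
  case 0
  then show ?case by (simp add: C_def algebra_simps)
next
  case (Suc m)
  define Q where "Q = q^m"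
  note nv = coeff_den_nonzero[OF q D]
  have st: "C (Suc m) = C m * shift_factor q b d \<kappa> w Q * cd_factor q b d \<kappa> w Q * bd_factor q b d \<kappa> w Q"
    "cleared_term q b d \<kappa> w m = coeff_tail q b d \<kappa> w 0 0 0 0 * (C m * shift_factor q b d \<kappa> w Q *
     ((1 - Q^2*(q/\<kappa>)) * (1 - q*Q^4*(\<kappa>*w)) / (1 - Q^2*(w/d)) + cd_factor q b d \<kappa> w Q *
       ((1 - q*Q^2*(q*w/b)) * (1 - q^2*Q^4*b) / (1 - q*Q^2*(w/d)))) + C (Suc m) * (1 - (q*Q)^4*d))"
    unfolding C_def Q_def by (rule cleared_term_stage[OF q nz nv])+
  have fin': "qpoch (b*d/w) q k = 0" if "k \<ge> n" for k
    using qpoch_eq_0_mono[OF Suc.prems that] .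
  have "C m * (stage_sum q b d \<kappa> w Q (Suc n) - (1 - Q^4*d)) = C m * (shift_factor q b d \<kappa> w Q *
     ((1 - Q^2*(q/\<kappa>)) * (1 - q*Q^4*(\<kappa>*w)) / (1 - Q^2*(w/d)) + cd_factor q b d \<kappa> w Q *
       ((1 - q*Q^2*(q*w/b)) * (1 - q^2*Q^4*b) / (1 - q*Q^2*(w/d))
         + bd_factor q b d \<kappa> w Q * stage_sum q b d \<kappa> w (q*Q) n)))"
  \<comment> \<open>If \<open>C m = 0\<close>, both sides are zero. Otherwise no factor
    \<open>1 - q^j*(b*d/w)\<close> with \<open>j < 2*m\<close> vanishes, so the one that ends the
    sum comes later and \<open>stage_sum_Suc\<close> applies.\<close>
  proof (cases "C m = 0")
    case False
    hence "(\<Prod>j<2*m. w - q^j*(b*d)) \<noteq> 0"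
      by (auto simp: C_def coeff_num_def)
    hence "qpoch (b*d/w) q (2*m) \<noteq> 0"
      using nz by (auto simp: qpoch_eq_0_iff field_simps)
    hence g: "qpoch (Q^2*(b*d/w)) q (Suc n) = 0"
      using fin'[of "2*m + Suc n"] unfolding qpoch_add Q_def power_even_eq[symmetric] by simp
    have Q0: "Q \<noteq> 0" using nz by (simp add: Q_def)
    have Qp: "q^(2*m) = Q^2" "q^(3*m) = Q^3"
      by (simp_all only: Q_def power_mult[symmetric] mult.commute)
    have "qpoch (Q^3*q) q k \<noteq> 0" "qpoch (Q^3*(b*d*\<kappa>)) q k \<noteq> 0" "qpoch (Q^2*(q*w/b)) q k \<noteq> 0"
      "qpoch (Q^2*(q/\<kappa>)) q k \<noteq> 0" "qpoch (Q^2*(w/d)) q k \<noteq> 0" for k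
      using nv[of "3*m+k" "2*m+k" "2*m+k" "2*m+k"] by (simp_all add: coeff_den_def qpoch_add Qp)
    from stage_sum_Suc[OF nz Q0 this g] show ?thesis
      by simp
  qed simp
  also have "\<dots> = C m * shift_factor q b d \<kappa> w Q *
     ((1 - Q^2*(q/\<kappa>)) * (1 - q*Q^4*(\<kappa>*w)) / (1 - Q^2*(w/d)) + cd_factor q b d \<kappa> w Q *
       ((1 - q*Q^2*(q*w/b)) * (1 - q^2*Q^4*b) / (1 - q*Q^2*(w/d))))
     + C (Suc m) * stage_sum q b d \<kappa> w (q*Q) n"
    unfolding st(1) by (simp only: ring_distribs mult.assoc add.assoc)
  finally have *: "C m * (stage_sum q b d \<kappa> w Q (Suc n) - (1 - Q^4*d)) = \<dots>" .
  have "coeff_tail q b d \<kappa> w 0 0 0 0 * stage_sum q b d \<kappa> w 1 (n + Suc m) =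
    coeff_tail q b d \<kappa> w 0 0 0 0 * (1 - d) + (\<Sum>i<m. cleared_term q b d \<kappa> w i)
    + coeff_tail q b d \<kappa> w 0 0 0 0 * (C m * (stage_sum q b d \<kappa> w Q (Suc n) - (1 - Q^4*d)))"
    using Suc.IH[of "Suc n"] fin'[of "Suc n"] by (simp add: Q_def)
  also have "\<dots> = coeff_tail q b d \<kappa> w 0 0 0 0 * (1 - d) + (\<Sum>i<Suc m. cleared_term q b d \<kappa> w i)
    + coeff_tail q b d \<kappa> w 0 0 0 0 * (C (Suc m) * (stage_sum q b d \<kappa> w (q*Q) n - (1 - (q*Q)^4*d)))"
    unfolding * sum.lessThan_Suc st(2) by (simp only: ring_distribs mult.assoc) simp
  finally show ?case
    by (simp only: Q_def power_Suc)
qed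

text \<open>After \<open>m\<close> rounds with \<open>n \<le> 2*m\<close> the vanishing factor has
  entered \<open>coeff_num\<close>, so the remainder is zero. The initial sum is evaluated by
  \<open>wp_sum_6phi5\<close>.\<close>

lemma terminating_identity:
  fixes q b d \<kappa> w :: complex
  assumes q: "0 < norm q" "norm q < 1" and nz: "b \<noteq> 0" "d \<noteq> 0" "\<kappa> \<noteq> 0" "w \<noteq> 0"
    and D: "coeff_tail q b d \<kappa> w 0 0 0 0 \<noteq> 0"
    and fin: "qpoch (b*d/w) q n = 0" and m: "n \<le> 2*m"
  shows "qpoch_inf q q * qpoch_inf d q * qpoch_inf b q * qpoch_inf (\<kappa>*w) q * qpoch_inf (q*w/(b*d*\<kappa>)) q
    = coeff_tail q b d \<kappa> w 0 0 0 0 * (1 - d) + (\<Sum>i<m. cleared_term q b d \<kappa> w i)"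
proof -
  have q0: "q \<noteq> 0" using q by auto
  have "qpoch (b*d/w) q (2*m) = 0"
    using qpoch_eq_0_mono[OF fin m] .
  hence "\<exists>j<2*m. w - q^j*(b*d) = 0"
    using nz by (auto simp: qpoch_eq_0_iff field_simps)
  hence "coeff_num q b d \<kappa> w m = 0"
    by (auto simp: coeff_num_def)
  with stage_sum_expand[OF q(2) q0 nz D fin, of m]
  have "coeff_tail q b d \<kappa> w 0 0 0 0 * (1 - d) + (\<Sum>i<m. cleared_term q b d \<kappa> w i)
      = coeff_tail q b d \<kappa> w 0 0 0 0 * stage_sum q b d \<kappa> w 1 (n + m)"
    by simp
  \<comment> \<open>For \<open>Q = 1\<close> the first two parameters of \<open>wp_sum\<close> are
    both \<open>d\<close>; after a permutation this is the case \<open>e = a\<close>.\<close>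
  also have "stage_sum q b d \<kappa> w 1 (n + m) = wp_sum q d (b*d/w) (\<kappa>*d) (q/(b*\<kappa>)) d (w/d) (n + m)"
    unfolding stage_sum_def by (simp add: wp_sum_def wp_summand_def mult_ac)
  also have "\<dots> = qpoch_inf d q * qpoch_inf (q*d/((b*d/w)*(\<kappa>*d))) q * qpoch_inf (q*d/((b*d/w)*(q/(b*\<kappa>)))) q * qpoch_inf (q*d/((\<kappa>*d)*(q/(b*\<kappa>)))) q
      / (qpoch_inf (w/d) q * qpoch_inf (q*d/(b*d/w)) q * qpoch_inf (q*d/(\<kappa>*d)) q * qpoch_inf (q*d/(q/(b*\<kappa>))) q)"
    by (rule wp_sum_6phi5) (use q q0 nz D fin in \<open>simp_all add: coeff_tail_def qpoch_add mult_ac\<close>)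
  also have "\<dots> = qpoch_inf d q * qpoch_inf (q*w/(b*d*\<kappa>)) q * qpoch_inf (\<kappa>*w) q * qpoch_inf b q
      / (qpoch_inf (w/d) q * qpoch_inf (q*w/b) q * qpoch_inf (q/\<kappa>) q * qpoch_inf (b*d*\<kappa>) q)"
  proof -
    have "q*d/((b*d/w)*(\<kappa>*d)) = q*w/(b*d*\<kappa>)" "q*d/((b*d/w)*(q/(b*\<kappa>))) = \<kappa>*w"
      "q*d/((\<kappa>*d)*(q/(b*\<kappa>))) = b" "q*d/(b*d/w) = q*w/b" "q*d/(\<kappa>*d) = q/\<kappa>" "q*d/(q/(b*\<kappa>)) = b*d*\<kappa>"
      using nz q0 by (simp_all add: field_simps)
    thus ?thesis by simp
  qed
  finally show ?thesis
    using D by (simp add: coeff_tail_def)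
qed

section \<open>Analytic continuation\<close>

text \<open>The bound holds for all indices and on the whole disc. The closure rules below allow it
  to be read off from the shape of a term.\<close>

definition unif_bdd :: "real \<Rightarrow> (nat \<Rightarrow> complex \<Rightarrow> complex) \<Rightarrow> bool" where
  "unif_bdd R f \<longleftrightarrow> (\<exists>B. \<forall>m w. norm w \<le> R \<longrightarrow> norm (f m w) \<le> B)"

lemma unif_bddE:
  assumes "unif_bdd R f"
  obtains B where "B \<ge> 0" and "\<forall>m w. norm w \<le> R \<longrightarrow> norm (f m w) \<le> B"
proof -
  from assms obtain B where "\<forall>m w. norm w \<le> R \<longrightarrow> norm (f m w) \<le> B"
    unfolding unif_bdd_def by blast
  thus ?thesis
    by (intro that[of "max B 0"]) (auto intro: max.coboundedI1)
qed

lemma unif_bdd_const: "unif_bdd R (\<lambda>m w. c)"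
  unfolding unif_bdd_def by auto

lemma unif_bdd_ident: "unif_bdd R (\<lambda>m w. w)"
  unfolding unif_bdd_def by auto

lemma unif_bdd_mult:
  assumes "unif_bdd R f" "unif_bdd R g"
  shows "unif_bdd R (\<lambda>m w. f m w * g m w)"
proof -
  obtain B where B: "B \<ge> 0" "\<forall>m w. norm w \<le> R \<longrightarrow> norm (f m w) \<le> B"
    using assms(1) by (rule unif_bddE)
  obtain C where C: "C \<ge> 0" "\<forall>m w. norm w \<le> R \<longrightarrow> norm (g m w) \<le> C"
    using assms(2) by (rule unif_bddE)
  show ?thesis
    unfolding unif_bdd_def
    by (intro exI[of _ "B * C"])
       (auto simp: norm_mult intro!: mult_mono B(1) C(1) B(2)[rule_format] C(2)[rule_format])
qed

lemma unif_bdd_divide: "unif_bdd R f \<Longrightarrow> unif_bdd R (\<lambda>m w. f m w / c)"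
  unfolding divide_inverse by (intro unif_bdd_mult unif_bdd_const)

lemma unif_bdd_diff:
  assumes "unif_bdd R f" "unif_bdd R g"
  shows "unif_bdd R (\<lambda>m w. f m w - g m w)"
proof -
  obtain B where B: "\<And>m w. norm w \<le> R \<Longrightarrow> norm (f m w) \<le> B"
    using assms(1) unfolding unif_bdd_def by blast
  obtain C where C: "\<And>m w. norm w \<le> R \<Longrightarrow> norm (g m w) \<le> C"
    using assms(2) unfolding unif_bdd_def by blast
  show ?thesis
    unfolding unif_bdd_def
    by (intro exI[of _ "B + C"]) (auto intro!: order.trans[OF norm_triangle_ineq4] add_mono B C)
qed

lemma unif_bdd_add:
  assumes "unif_bdd R f" "unif_bdd R g"
  shows "unif_bdd R (\<lambda>m w. f m w + g m w)"
  using unif_bdd_diff[OF assms(1) unif_bdd_mult[OF unif_bdd_const[of R "-1"] assms(2)]] by simp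

lemma unif_bdd_power:
  assumes "norm q < 1"
  shows "unif_bdd R (\<lambda>m w. q ^ k m)"
  unfolding unif_bdd_def using assms
  by (intro exI[of _ 1]) (auto simp: norm_power intro!: power_le_one)

lemma unif_bdd_qpoch:
  assumes "norm q < 1" "unif_bdd R f"
  shows "unif_bdd R (\<lambda>m w. qpoch (f m w) q (k m))"
    and "unif_bdd R (\<lambda>m w. qpoch_inf (f m w) q)"
proof -
  obtain B where B: "\<And>m w. norm w \<le> R \<Longrightarrow> norm (f m w) \<le> B"
    using assms(2) unfolding unif_bdd_def by blast
  have *: "exp (norm (f m w) / (1 - norm q)) \<le> exp (B / (1 - norm q))" if "norm w \<le> R" for m w
    using B[OF that] assms(1) by (simp add: divide_right_mono)
  show "unif_bdd R (\<lambda>m w. qpoch (f m w) q (k m))"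
    unfolding unif_bdd_def
    by (intro exI[of _ "exp (B / (1 - norm q))"]) (auto intro: order.trans[OF norm_qpoch_le[OF assms(1)] *])
  show "unif_bdd R (\<lambda>m w. qpoch_inf (f m w) q)"
    unfolding unif_bdd_def
    by (intro exI[of _ "exp (B / (1 - norm q))"]) (auto intro: order.trans[OF norm_qpoch_inf_le[OF assms(1)] *])
qed

lemmas unif_bdd_intros = unif_bdd_const unif_bdd_ident unif_bdd_mult unif_bdd_divide
  unif_bdd_diff unif_bdd_add unif_bdd_power unif_bdd_qpoch

text \<open>The term is \<open>(\<rho> * r^m)^m\<close>, and its base tends to 0.\<close>

lemma summable_power_mult_power_square:
  fixes \<rho> r :: real
  assumes "0 \<le> r" "r < 1"
  shows "summable (\<lambda>m. \<rho>^m * r^(m^2))"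
proof -
  have "(\<lambda>m. \<bar>\<rho>\<bar> * r^m) \<longlonglongrightarrow> \<bar>\<rho>\<bar> * 0"
    using assms by (intro tendsto_mult_left LIMSEQ_realpow_zero)
  hence "eventually (\<lambda>m. \<bar>\<rho>\<bar> * r^m < 1/2) sequentially"
    by (rule order_tendstoD(2)) simp
  hence "eventually (\<lambda>m. norm (\<rho>^m * r^(m^2)) \<le> (1/2)^m) sequentially"
  proof eventually_elim
    case (elim m)
    have "norm (\<rho>^m * r^(m^2)) = (\<bar>\<rho>\<bar> * r^m)^m"
      using assms(1) by (simp add: power_mult_distrib power2_eq_square power_mult abs_mult power_abs)
    also have "\<dots> \<le> (1/2)^m"
      using elim assms(1) by (intro power_mono) auto
    finally show ?case .
  qed
  thus ?thesis
    by (rule summable_comparison_test_ev) (simp add: summable_geometric)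
qed

text \<open>The shifted factorials are uniformly bounded and the product of the \<open>2*m\<close>
  factors \<open>w - q^j*(b*d)\<close> grows at most geometrically, so \<open>q^(3*m^2)\<close> wins
  on every disc.\<close>

lemma norm_coeff_num_le:
  assumes "norm q < 1"
  shows "\<exists>B\<ge>0. \<forall>m w. norm w \<le> R \<longrightarrow>
    norm (coeff_num q b d \<kappa> w m) \<le> B * ((norm (1/(b*d*\<kappa>)) * (R + norm (b*d))^2)^m * (norm q^3)^(m^2))"
proof -
  have "unif_bdd R (\<lambda>m w. qpoch d q m * qpoch (\<kappa>*d) q (2*m) * qpoch (q/(b*\<kappa>)) q m * qpoch (q*w/(b*d)) q m
     * qpoch (b*\<kappa>) q (2*m) * qpoch (\<kappa>*w) q m * qpoch (q/(\<kappa>*d)) q m * qpoch b q m)"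
    by (intro unif_bdd_intros assms)
  then obtain B where B: "B \<ge> 0" "\<forall>m w. norm w \<le> R \<longrightarrow> norm (qpoch d q m * qpoch (\<kappa>*d) q (2*m)
     * qpoch (q/(b*\<kappa>)) q m * qpoch (q*w/(b*d)) q m
     * qpoch (b*\<kappa>) q (2*m) * qpoch (\<kappa>*w) q m * qpoch (q/(\<kappa>*d)) q m * qpoch b q m) \<le> B"
    by (rule unif_bddE)
  have "norm (coeff_num q b d \<kappa> w m) \<le> B * ((norm (1/(b*d*\<kappa>)) * (R + norm (b*d))^2)^m * (norm q^3)^(m^2))"
    if w: "norm w \<le> R" for m w
  proof -
    have "norm (\<Prod>j<2*m. w - q^j*(b*d)) \<le> (\<Prod>j<2*m. R + norm (b*d))"
      unfolding prod_norm[symmetric]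
    proof (rule prod_mono, safe)
      fix j
      have "norm (w - q^j*(b*d)) \<le> norm w + norm q^j * norm (b*d)"
        by (metis norm_mult norm_power norm_triangle_ineq4)
      also have "\<dots> \<le> R + 1 * norm (b*d)"
        using assms w by (intro add_mono mult_right_mono power_le_one) auto
      finally show "norm (w - q^j*(b*d)) \<le> R + norm (b*d)" by simp
    qed simp
    also have "\<dots> = ((R + norm (b*d))^2)^m"
      by (simp add: power_mult)
    finally have p: "norm (\<Prod>j<2*m. w - q^j*(b*d)) \<le> ((R + norm (b*d))^2)^m" .
    have "norm (coeff_num q b d \<kappa> w m) \<le> norm q^(3*m^2) * norm (1/(b*d*\<kappa>))^m * ((R + norm (b*d))^2)^m * B"
      unfolding coeff_num_def norm_mult[of _ "qpoch d q m * _ * _ * _ * _ * _ * _ * _"] norm_mult[of _ "prod _ _"] norm_mult[of "_ ^ _" "_ ^ _"] norm_power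
      by (intro mult_mono B(2)[rule_format] w p mult_nonneg_nonneg zero_le_power norm_ge_zero order.refl zero_le_power2)
    thus ?thesis
      by (simp add: power_mult_distrib power_mult mult_ac)
  qed
  with B(1) show ?thesis by blast
qed

lemma norm_cleared_term_le:
  assumes "norm q < 1"
  shows "\<exists>M. summable M \<and> (\<forall>m w. norm w \<le> R \<longrightarrow> norm (cleared_term q b d \<kappa> w m) \<le> M m)"
proof -
  have Q4: "(q^m)^k = q^(m*k)" for m k
    by (rule power_mult[symmetric])
  \<comment> \<open>The cofactors \<open>g\<close> and \<open>h\<close> of the two coefficients are
    merely bounded; all decay comes from \<open>coeff_num\<close>.\<close>
  define g where "g m w = shift_num q b d \<kappa> w (q^m) *
       ((1 - q*(q^m)^4*(\<kappa>*w)) * coeff_tail q b d \<kappa> w (3*m+1) (2*m+1) (2*m) (2*m+1)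
        + cd_num q b d \<kappa> w (q^m) * (1 - q^2*(q^m)^4*b) * coeff_tail q b d \<kappa> w (3*m+2) (2*m+1) (2*m+1) (2*m+2))" for m w
  define h where "h m w = (1 - (q^Suc m)^4*d) * coeff_tail q b d \<kappa> w (3*Suc m) (2*Suc m) (2*Suc m) (2*Suc m)" for m w
  have "unif_bdd R g" "unif_bdd R h"
    unfolding g_def h_def shift_num_def cd_num_def coeff_tail_def Q4 by (intro unif_bdd_intros assms)+
  then obtain G H where G: "G \<ge> 0" "\<forall>m w. norm w \<le> R \<longrightarrow> norm (g m w) \<le> G"
    and H: "H \<ge> 0" "\<forall>m w. norm w \<le> R \<longrightarrow> norm (h m w) \<le> H"
    by (elim unif_bddE)
  define N where "N m = (norm (1/(b*d*\<kappa>)) * (R + norm (b*d))^2)^m * (norm q^3)^(m^2)" for m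
  obtain B where B: "B \<ge> 0" "\<And>m w. norm w \<le> R \<Longrightarrow> norm (coeff_num q b d \<kappa> w m) \<le> B * N m"
    using norm_coeff_num_le[OF assms, of R b d \<kappa>] unfolding N_def by blast
  have N: "summable N"
    unfolding N_def using assms by (intro summable_power_mult_power_square) (auto simp: power_less_one_iff)
  hence "summable (\<lambda>m. B * N m * G + B * N (Suc m) * H)"
    by (intro summable_add summable_mult2 summable_mult) (simp_all only: summable_Suc_iff)
  moreover have "norm (cleared_term q b d \<kappa> w m) \<le> B * N m * G + B * N (Suc m) * H" if w: "norm w \<le> R" for m w
  proof -
    have "N k \<ge> 0" for k
      by (simp add: N_def)
    have "cleared_term q b d \<kappa> w m = coeff_num q b d \<kappa> w m * g m w + coeff_num q b d \<kappa> w (Suc m) * h m w"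
      unfolding cleared_term_def g_def h_def by (simp only: mult.assoc)
    also have "norm \<dots> \<le> norm (coeff_num q b d \<kappa> w m) * norm (g m w) + norm (coeff_num q b d \<kappa> w (Suc m)) * norm (h m w)"
      by (metis norm_mult norm_triangle_ineq)
    also have "\<dots> \<le> B * N m * G + B * N (Suc m) * H"
      using \<open>\<And>k. N k \<ge> 0\<close> B(1) by (intro add_mono mult_mono B(2) G(2)[rule_format] H(2)[rule_format] w) auto
    finally show ?thesis .
  qed
  ultimately show ?thesis by blast
qed

lemma suminf_entire:
  fixes f :: "nat \<Rightarrow> complex \<Rightarrow> complex"
  assumes hol: "\<And>m. f m holomorphic_on UNIV"
    and bd: "\<And>R. \<exists>M. summable M \<and> (\<forall>m w. norm w \<le> R \<longrightarrow> norm (f m w) \<le> M m)"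
  shows "(\<lambda>w. \<Sum>m. f m w) holomorphic_on UNIV" and "summable (\<lambda>m. f m w)"
proof -
  show "(\<lambda>w. \<Sum>m. f m w) holomorphic_on UNIV"
  proof (rule holomorphic_uniform_sequence)
    fix x :: complex
    obtain M where M: "summable M" "\<And>m w. norm w \<le> norm x + 1 \<Longrightarrow> norm (f m w) \<le> M m"
      using bd by blast
    have "uniform_limit (cball x 1) (\<lambda>n w. \<Sum>m<n. f m w) (\<lambda>w. \<Sum>m. f m w) sequentially"
    proof (rule Weierstrass_m_test)
      fix m w assume "w \<in> cball x 1"
      hence "norm w \<le> norm x + 1"
        using norm_triangle_ineq2[of w x] by (simp add: dist_norm norm_minus_commute)
      thus "norm (f m w) \<le> M m" by (rule M)
    qed (rule M)
    thus "\<exists>r>0. cball x r \<subseteq> UNIV \<and> uniform_limit (cball x r) (\<lambda>n w. \<Sum>m<n. f m w) (\<lambda>w. \<Sum>m. f m w) sequentially"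
      by (intro exI[of _ 1]) auto
  qed (auto intro!: holomorphic_intros hol)
  obtain M where "summable M" "\<And>m. norm (f m w) \<le> M m"
    using bd[of "norm w"] by blast
  thus "summable (\<lambda>m. f m w)"
    by (rule summable_comparison_test'[where N = 0])
qed

lemma coeff_tail_holomorphic [holomorphic_intros]:
  assumes "norm q < 1"
  shows "(\<lambda>w. coeff_tail q b d \<kappa> w i j k l) holomorphic_on S"
  unfolding coeff_tail_def divide_inverse by (intro holomorphic_intros assms)

lemma cleared_term_holomorphic:
  assumes "norm q < 1"
  shows "(\<lambda>w. cleared_term q b d \<kappa> w m) holomorphic_on S"
  unfolding cleared_term_def coeff_num_def shift_num_def cd_num_def divide_inverse
  by (intro holomorphic_intros assms)

text \<open>Both sides are entire in \<open>w\<close> and agree at \<open>w = b*d*q^n\<close> for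
  large \<open>n\<close>, where the sum terminates. The assumptions make \<open>coeff_tail\<close>
  nonzero at 0, hence at these points once they are close to 0.\<close>

lemma entire_identity:
  fixes q b d \<kappa> w :: complex
  assumes q: "0 < norm q" "norm q < 1" and nz: "b \<noteq> 0" "d \<noteq> 0" "\<kappa> \<noteq> 0"
    and nv: "qpoch_inf (q/\<kappa>) q \<noteq> 0" "qpoch_inf (b*d*\<kappa>) q \<noteq> 0"
  shows "qpoch_inf q q * qpoch_inf d q * qpoch_inf b q * qpoch_inf (\<kappa>*w) q * qpoch_inf (q*w/(b*d*\<kappa>)) q
    = coeff_tail q b d \<kappa> w 0 0 0 0 * (1 - d) + (\<Sum>i. cleared_term q b d \<kappa> w i)"
proof -
  define f where "f w = qpoch_inf q q * qpoch_inf d q * qpoch_inf b q * qpoch_inf (\<kappa>*w) q * qpoch_inf (q*w/(b*d*\<kappa>)) q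
    - (coeff_tail q b d \<kappa> w 0 0 0 0 * (1 - d) + (\<Sum>i. cleared_term q b d \<kappa> w i))" for w
  note ent = suminf_entire[OF cleared_term_holomorphic[OF q(2)] norm_cleared_term_le[OF q(2)], of b d \<kappa>]
  have hol: "f holomorphic_on UNIV"
    unfolding f_def divide_inverse by (intro holomorphic_intros q(2) ent)
  have q0: "q \<noteq> 0" using q by auto
  define x where "x n = b*d*q^n" for n
  have x: "x \<longlonglongrightarrow> 0"
    unfolding x_def using LIMSEQ_power_zero[OF q(2)] by (rule tendsto_mult_right_zero)
  have "coeff_tail q b d \<kappa> 0 0 0 0 0 \<noteq> 0"
    using nv qpoch_inf_q_nonzero[OF q(2)] by (simp add: coeff_tail_def qpoch_inf_def)
  moreover have "(\<lambda>n. coeff_tail q b d \<kappa> (x n) 0 0 0 0) \<longlonglongrightarrow> coeff_tail q b d \<kappa> 0 0 0 0 0"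
  proof (rule isCont_tendsto_compose[OF _ x])
    have "continuous_on UNIV (\<lambda>w. coeff_tail q b d \<kappa> w 0 0 0 0)"
      by (intro holomorphic_on_imp_continuous_on holomorphic_intros q(2))
    thus "isCont (\<lambda>w. coeff_tail q b d \<kappa> w 0 0 0 0) 0"
      by (simp add: continuous_on_eq_continuous_at)
  qed
  ultimately have "eventually (\<lambda>n. coeff_tail q b d \<kappa> (x n) 0 0 0 0 \<noteq> 0) sequentially"
    by (rule tendsto_imp_eventually_ne[rotated])
  hence zero: "eventually (\<lambda>n. f (x n) = 0) sequentially"
  proof eventually_elim
    case (elim n)
    \<comment> \<open>As \<open>b*d/x n\<close> is the inverse of \<open>q^n\<close>, the factor
      with index \<open>n\<close> is zero.\<close>
    have "qpoch (b*d/x n) q (Suc n) = 0"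
      using nz q0 by (simp add: qpoch_Suc x_def)
    hence eq: "qpoch_inf q q * qpoch_inf d q * qpoch_inf b q * qpoch_inf (\<kappa>*x n) q * qpoch_inf (q*x n/(b*d*\<kappa>)) q
        - coeff_tail q b d \<kappa> (x n) 0 0 0 0 * (1 - d) = (\<Sum>i<m. cleared_term q b d \<kappa> (x n) i)" if "Suc n \<le> 2*m" for m
      using terminating_identity[OF q nz _ elim _ that] nz q0 by (simp add: x_def)
    \<comment> \<open>The partial sums are eventually constant, so the infinite sum is that
      constant.\<close>
    have "eventually (\<lambda>m. (\<Sum>i<m. cleared_term q b d \<kappa> (x n) i) = qpoch_inf q q * qpoch_inf d q * qpoch_inf b q
        * qpoch_inf (\<kappa>*x n) q * qpoch_inf (q*x n/(b*d*\<kappa>)) q - coeff_tail q b d \<kappa> (x n) 0 0 0 0 * (1 - d)) sequentially"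
      using eventually_ge_at_top[of "Suc n"] by eventually_elim (rule eq[symmetric], simp)
    hence "(\<lambda>m. \<Sum>i<m. cleared_term q b d \<kappa> (x n) i) \<longlonglongrightarrow> qpoch_inf q q * qpoch_inf d q * qpoch_inf b q
        * qpoch_inf (\<kappa>*x n) q * qpoch_inf (q*x n/(b*d*\<kappa>)) q - coeff_tail q b d \<kappa> (x n) 0 0 0 0 * (1 - d)"
      by (rule tendsto_eventually)
    hence "(\<Sum>i. cleared_term q b d \<kappa> (x n) i) = qpoch_inf q q * qpoch_inf d q * qpoch_inf b q
        * qpoch_inf (\<kappa>*x n) q * qpoch_inf (q*x n/(b*d*\<kappa>)) q - coeff_tail q b d \<kappa> (x n) 0 0 0 0 * (1 - d)"
      by (intro sums_unique[symmetric]) (simp add: sums_def)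
    thus "f (x n) = 0"
      by (simp add: f_def)
  qed
  have "0 islimpt {w. f w = 0}"
    unfolding islimpt_sequential
  proof -
    obtain k where k: "\<And>n. n \<ge> k \<Longrightarrow> f (x n) = 0"
      using zero unfolding eventually_sequentially by blast
    show "\<exists>y. (\<forall>n. y n \<in> {w. f w = 0} - {0}) \<and> y \<longlonglongrightarrow> 0"
      using k nz q0 LIMSEQ_ignore_initial_segment[OF x, of k]
      by (intro exI[of _ "\<lambda>n. x (n + k)"]) (auto simp: x_def)
  qed
  hence "f w = 0"
    by (intro analytic_continuation[OF hol open_UNIV connected_UNIV subset_UNIV UNIV_I, of 0 "{w. f w = 0}" w]) simp_all
  thus ?thesis
    by (simp add: f_def)
qed

section \<open>Identification of the summands\<close>

text \<open>For \<open>\<kappa> = c/a\<close> and \<open>w = a\<close> the product over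
  \<open>j\<close> supplies \<open>a^(2*m)\<close>, which completes \<open>1/(b*d*\<kappa>)\<close>
  to \<open>a^3/(b*c*d)\<close>.\<close>

lemma coeff_num_eq:
  assumes "a \<noteq> 0" "b \<noteq> 0" "c \<noteq> 0" "d \<noteq> 0"
  shows "coeff_num q b d (c/a) a m = q^(3*m^2) * (a^3/(b*c*d))^m * (qpoch b q m * qpoch c q m * qpoch d q m
    * qpoch (q*a/(b*c)) q m * qpoch (q*a/(b*d)) q m * qpoch (q*a/(c*d)) q m
    * qpoch (b*c/a) q (2*m) * qpoch (b*d/a) q (2*m) * qpoch (c*d/a) q (2*m))"
proof -
  have V: "(\<Prod>j<k. a - q^j*(b*d)) = a^k * qpoch (b*d/a) q k" for k
    using assms(1) by (induction k) (simp_all add: qpoch_Suc field_simps)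
  have "1/(b*d*(c/a)) * a^2 = a^3/(b*c*d)"
    using assms by (simp add: eval_nat_numeral mult_ac)
  hence p: "(1/(b*d*(c/a)))^m * a^(2*m) = (a^3/(b*c*d))^m"
    by (simp only: power_mult power_mult_distrib[symmetric])
  have e: "c/a*d = c*d/a" "q/(b*c/a) = q*a/(b*c)" "b*(c/a) = b*c/a" "c/a*a = c" "q/(c*d/a) = q*a/(c*d)"
    using assms by simp_all
  show ?thesis
    unfolding coeff_num_def V p[symmetric] e by (simp only: mult_ac)
qed

lemma power_int_eq_power: "k = int j \<Longrightarrow> x powi k = x ^ j"
  by simp

lemma power_int_eq_inverse_power: "k = - int j \<Longrightarrow> x powi k = 1 / (x::complex) ^ j"
  by (simp only: power_int_minus power_int_of_nat inverse_eq_divide)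

text \<open>With free letters for the linear factors only cancellation of monomials is left.
  \<open>?V * ?B\<close> is the boundary term of the second relation; \<open>- ?X\<close> and
  \<open>- ?Y\<close> are the ratios to it of the next term \<open>k = 0\<close> and of the boundary
  term of the first relation. These account for the three terms in the braces of
  \<open>W\<close>.\<close>

lemma summand_algebra:
  fixes a b c d q Q :: complex
  assumes nz: "a \<noteq> 0" "b \<noteq> 0" "c \<noteq> 0" "d \<noteq> 0" "q \<noteq> 0" "Q \<noteq> 0"
    and nz': "Ab \<noteq> 0" "Ac \<noteq> 0" "r \<noteq> 0" "e \<noteq> 0" "f1 \<noteq> 0" "f2 \<noteq> 0" "h1 \<noteq> 0" "h1' \<noteq> 0" "h2' \<noteq> 0" "h3' \<noteq> 0" "g2 \<noteq> 0"
      "E2 \<noteq> 0" "u1 \<noteq> 0" "u2 \<noteq> 0" "u3 \<noteq> 0" "p1 \<noteq> 0" "p2 \<noteq> 0" "p3 \<noteq> 0" "x1 \<noteq> 0" "x2 \<noteq> 0" "y1 \<noteq> 0" "y2 \<noteq> 0" "t1 \<noteq> 0" "t2 \<noteq> 0"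
  shows "(u3 * (- (b/a) * Ab) * (- (c/a) * Ac) * p3 * E2) / ((- (c*d/a) * r) * (- e/d) * f1 * h1' * h2')
      * (1 - (f1 * h1' * h2' * r' * E3) / (u3 * (- (b/(q^2*Q^2*a)) * x2) * y2 * p3 * E2)
           - (u2 * (- (c/(q*Q^2*a)) * y1) * t2 * p2 * E1) / (f2 * h1 * g2 * h3' * E2))
      * (C * (Q^4*q*(a^3/(b*c*d))) * (f1*f2*f3*g1*g2*r*(h1*h1')*(h2*h2')*(h3*h3') / (Ab*Ac*x1*y1*t1*t2*(u1*u2*u3)*(p1*p2*p3))))
    = (C * (Q^2*(a/d)*f3*g1*h2*h3 / (u1*p1*x1*y1)) * (y1*E1/t1 + (Q^2*(q*a/c)*h3'*h1*g2*f2 / (t1*u2*p2*x2)) * (x2*E2/t2))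
       + C * (Q^2*(a/d)*f3*g1*h2*h3 / (u1*p1*x1*y1)) * (Q^2*(q*a/c)*h3'*h1*g2*f2 / (t1*u2*p2*x2))
         * (q*Q^2*(q*a/b)*h2'*h1'*r'*f1 / (t2*u3*p3*y2)) * E3) / e" (is "?V * (1 - ?X - ?Y) * ?B = _")
proof -
  have V: "?V * ?B = C * (Q^2*(a/d)*f3*g1*h2*h3 / (u1*p1*x1*y1)) * ((Q^2*(q*a/c)*h3'*h1*g2*f2 / (t1*u2*p2*x2)) * (x2*E2/t2)) / e"
    using nz nz' by (simp add: eval_nat_numeral mult_ac)
  have X: "- ?X = (q*Q^2*(q*a/b)*h2'*h1'*r'*f1 / (t2*u3*p3*y2)) * E3 / (x2*E2/t2)"
    using nz nz' by (simp add: eval_nat_numeral mult_ac)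
  have Y: "- ?Y = y1*E1/t1 / ((Q^2*(q*a/c)*h3'*h1*g2*f2 / (t1*u2*p2*x2)) * (x2*E2/t2))"
    using nz nz' by (simp add: eval_nat_numeral mult_ac)
  have "?V * (1 - ?X - ?Y) * ?B = ?V * ?B * (1 + - ?X + - ?Y)"
    by (simp only: mult_ac diff_conv_add_uminus)
  also have "\<dots> = (C * (Q^2*(a/d)*f3*g1*h2*h3 / (u1*p1*x1*y1)) * (y1*E1/t1 + (Q^2*(q*a/c)*h3'*h1*g2*f2 / (t1*u2*p2*x2)) * (x2*E2/t2))
       + C * (Q^2*(a/d)*f3*g1*h2*h3 / (u1*p1*x1*y1)) * (Q^2*(q*a/c)*h3'*h1*g2*f2 / (t1*u2*p2*x2))
         * (q*Q^2*(q*a/b)*h2'*h1'*r'*f1 / (t2*u3*p3*y2)) * E3) / e"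
  proof -
    have gen: "C * F * (G * v) / e * (1 + H * E3 / v + w / (G * v)) = (C * F * (w + G * v) + C * F * G * H * E3) / e"
      if "G \<noteq> 0" "v \<noteq> 0" for F G H v w :: complex
      using that nz'(4) by (simp add: field_simps)
    show ?thesis
      unfolding V X Y by (rule gen) (use nz nz' in auto)
  qed
  finally show ?thesis .
qed

text \<open>Round \<open>m\<close> yields the summand with index \<open>m + 1\<close>. The divisor
  \<open>1 - d\<close> normalises the sum and reappears as \<open>1 - 1/d\<close> in
  \<open>W\<close>.\<close>

lemma summand_eq_cleared_term:
  fixes q a b c d :: complex
  assumes q: "norm q < 1" and nz: "q \<noteq> 0" "a \<noteq> 0" "b \<noteq> 0" "c \<noteq> 0" "d \<noteq> 0"
    and nzd: "no_zero_denominator q a b c d"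
    and D: "coeff_tail q b d (c/a) a 0 0 0 0 \<noteq> 0"
  shows "summand q (Suc m) a b c d = cleared_term q b d (c/a) a m / (coeff_tail q b d (c/a) a 0 0 0 0 * (1 - d))"
proof -
  define Q where "Q = q^m"
  define N where "N = int (Suc m)"
  define C where "C = (\<lambda>m. coeff_num q b d (c/a) a m / coeff_den q b d (c/a) a (3*m) (2*m) (2*m) (2*m))"
  have Q0: "Q \<noteq> 0" using nz by (simp add: Q_def)
  have Q1: "q^m = Q" by (simp add: Q_def)
  have Qp: "q^(2*m) = Q^2" "q^(3*m) = Q^3" "q^(4*m) = Q^4"
    by (simp_all only: Q_def power_mult[symmetric] mult.commute)
  note pa = power_add Q1 Qp power_one_right
  have pw: "q powi (3*N) = q^2*Q^3*q" "q powi (3*N - 1) = q^2*Q^3" "q powi (4*N - 2) = q^2*Q^4" "q powi (N - 1) = Q" "q powi (2*N - 1) = q*Q^2" "q powi (N) = Q*q" "q powi (4*N) = (q*Q)^4" "q powi (2*N) = q^2*Q^2" "q powi (3*N - 2) = q*Q^3" "q powi (4*N - 3) = q*Q^4" "q powi (2*N - 2) = Q^2"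
    subgoal by (subst power_int_eq_power[of _ "3*m+3"], simp add: N_def, unfold pa) (simp add: power_mult_distrib eval_nat_numeral mult_ac)
    subgoal by (subst power_int_eq_power[of _ "3*m+2"], simp add: N_def, unfold pa) (simp add: power_mult_distrib eval_nat_numeral mult_ac)
    subgoal by (subst power_int_eq_power[of _ "4*m+2"], simp add: N_def, unfold pa) (simp add: power_mult_distrib eval_nat_numeral mult_ac)
    subgoal by (subst power_int_eq_power[of _ "m"], simp add: N_def, unfold pa) (simp add: power_mult_distrib eval_nat_numeral mult_ac)
    subgoal by (subst power_int_eq_power[of _ "2*m+1"], simp add: N_def, unfold pa) (simp add: power_mult_distrib eval_nat_numeral mult_ac)
    subgoal by (subst power_int_eq_power[of _ "m+1"], simp add: N_def, unfold pa) (simp add: power_mult_distrib eval_nat_numeral mult_ac)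
    subgoal by (subst power_int_eq_power[of _ "4*m+4"], simp add: N_def, unfold pa) (simp add: power_mult_distrib eval_nat_numeral mult_ac)
    subgoal by (subst power_int_eq_power[of _ "2*m+2"], simp add: N_def, unfold pa) (simp add: power_mult_distrib eval_nat_numeral mult_ac)
    subgoal by (subst power_int_eq_power[of _ "3*m+1"], simp add: N_def, unfold pa) (simp add: power_mult_distrib eval_nat_numeral mult_ac)
    subgoal by (subst power_int_eq_power[of _ "4*m+1"], simp add: N_def, unfold pa) (simp add: power_mult_distrib eval_nat_numeral mult_ac)
    subgoal by (subst power_int_eq_power[of _ "2*m"], simp add: N_def, unfold pa) (simp add: power_mult_distrib eval_nat_numeral mult_ac)
    done
  have pwm: "q powi (- 2*N) = 1/(q^2*Q^2)" "q powi (1 - 2*N) = 1/(q*Q^2)"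
    subgoal by (subst power_int_eq_inverse_power[of _ "2*m+2"], simp add: N_def, unfold pa) (simp add: mult.commute)
    subgoal by (subst power_int_eq_inverse_power[of _ "2*m+1"], simp add: N_def, unfold pa) (simp add: mult.commute)
    done
  define u1 u2 u3 where u: "u1 = 1 - Q^3*q" "u2 = 1 - q*Q^3*q" "u3 = 1 - q^2*Q^3*q"
  define p1 p2 p3 where p: "p1 = 1 - Q^3*(b*c*d/a)" "p2 = 1 - q*Q^3*(b*c*d/a)" "p3 = 1 - q^2*Q^3*(b*c*d/a)"
  define x1 x2 where x: "x1 = 1 - Q^2*(q*a/b)" "x2 = 1 - q*Q^2*(q*a/b)"
  define y1 y2 where y: "y1 = 1 - Q^2*(q*a/c)" "y2 = 1 - q*Q^2*(q*a/c)"
  define t1 t2 where t: "t1 = 1 - Q^2*(a/d)" "t2 = 1 - q*Q^2*(a/d)"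
  define E1 E2 E3 where E: "E1 = 1 - q*Q^4*c" "E2 = 1 - q^2*Q^4*b" "E3 = 1 - (q*Q)^4*d"
  define f1 f2 f3 where f: "f1 = 1 - Q*b" "f2 = 1 - Q*c" "f3 = 1 - Q*d"
  define g1 g2 where g: "g1 = 1 - Q*(q*a/(b*c))" "g2 = 1 - Q*(q*a/(b*d))"
  define h1 h1' h2 h2' h3 h3' where h: "h1 = 1 - Q^2*(b*c/a)" "h1' = 1 - q*Q^2*(b*c/a)" "h2 = 1 - Q^2*(b*d/a)"
    "h2' = 1 - q*Q^2*(b*d/a)" "h3 = 1 - Q^2*(c*d/a)" "h3' = 1 - q*Q^2*(c*d/a)"
  define Ab Ac r r' where r: "Ab = 1 - a/b" "Ac = 1 - a/c" "r = 1 - a/(c*d)" "r' = 1 - Q*(q*a/(c*d))"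
  note nd = nzd[unfolded no_zero_denominator_def]
  \<comment> \<open>Factors in \<open>b/a\<close>, \<open>c/a\<close>, \<open>c*d/a\<close> with no
    power or a negative power of \<open>q\<close> are reversed by
    \<open>1 - x = - x * (1 - 1/x)\<close>, to match the shifted factorials in \<open>a/b\<close>,
    \<open>a/c\<close>, \<open>a/(c*d)\<close>.\<close>
  have ar: "1 - b/a = - (b/a) * Ab" "1 - c/a = - (c/a) * Ac" "1 - c*d/a = - (c*d/a) * r" "1 - 1/d = - (1 - d)/d"
    "1 - 1/(q^2*Q^2)*(b/a) = - (b/(q^2*Q^2*a)) * x2" "1 - 1/(q*Q^2)*(c/a) = - (c/(q*Q^2*a)) * y1"
    "1 - Q*q*(a/(c*d)) = r'" "1 - Q*q*(a/(b*d)) = g2" "1 - q^2*Q^3 = u2" "1 - q^2*Q^2*(a/c) = y2"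
    using nz Q0 by (simp_all add: r x y g u field_simps power2_eq_square)
  have atoms: "1 - q^2*Q^3*q = u3" "1 - q^2*Q^3*(b*c*d/a) = p3" "1 - q^2*Q^4*b = E2" "1 - Q*b = f1"
    "1 - q*Q^2*(b*c/a) = h1'" "1 - q*Q^2*(b*d/a) = h2'" "1 - (q*Q)^4*d = E3" "1 - q*Q^2*(a/d) = t2"
    "1 - q*Q^3*(b*c*d/a) = p2" "1 - q*Q^4*c = E1" "1 - Q*c = f2" "1 - Q^2*(b*c/a) = h1" "1 - q*Q^2*(c*d/a) = h3'"
    by (simp_all only: u p E f h t)
  have W: "W q (Suc m) a b c d = (u3 * (- (b/a) * Ab) * (- (c/a) * Ac) * p3 * E2) / ((- (c*d/a) * r) * (- (1 - d)/d) * f1 * h1' * h2')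
      * (1 - (f1 * h1' * h2' * r' * E3) / (u3 * (- (b/(q^2*Q^2*a)) * x2) * y2 * p3 * E2)
           - (u2 * (- (c/(q*Q^2*a)) * y1) * t2 * p2 * E1) / (f2 * h1 * g2 * h3' * E2))"
    unfolding W_def Let_def N_def[symmetric] pw pwm ar atoms by (rule refl)
  have inst: "1 - q powi (N - 1) * b \<noteq> 0 \<and> 1 - q powi (2*N - 1) * (b*c/a) \<noteq> 0 \<and>
        1 - q powi (2*N - 1) * (b*d/a) \<noteq> 0 \<and> 1 - q powi (3*N) \<noteq> 0 \<and>
        1 - q powi (- 2*N) * (b/a) \<noteq> 0 \<and> 1 - q powi (2*N) * (a/c) \<noteq> 0 \<and>
        1 - q powi (3*N - 1) * (b*c*d/a) \<noteq> 0 \<and> 1 - q powi (4*N - 2) * b \<noteq> 0 \<and>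
        1 - q powi (N - 1) * c \<noteq> 0 \<and> 1 - q powi (2*N - 2) * (b*c/a) \<noteq> 0 \<and>
        1 - q powi N * (a/(b*d)) \<noteq> 0 \<and> 1 - q powi (2*N - 1) * (c*d/a) \<noteq> 0"
    using nd unfolding N_def Let_def by (elim conjE) (drule spec[of _ "Suc m"], drule mp, simp, assumption)
  have nz1: "f1 \<noteq> 0" "h1' \<noteq> 0" "h2' \<noteq> 0" "E2 \<noteq> 0" "f2 \<noteq> 0" "h1 \<noteq> 0" "g2 \<noteq> 0" "h3' \<noteq> 0"
    using inst unfolding pw pwm ar atoms by blast+
  have nv: "coeff_den q b d (c/a) a i j k l \<noteq> 0" for i j k l
    by (rule coeff_den_nonzero[OF q D])
  have e: "3*Suc m = Suc (Suc (Suc (3*m)))" "2*Suc m = Suc (Suc (2*m))"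
    by simp_all
  have Qs: "q^Suc (2*m) = q*Q^2" "q^Suc (3*m) = q*Q^3" "q^Suc (Suc (3*m)) = q^2*Q^3"
    by (simp_all add: Qp power2_eq_square)
  have ka: "q/(c/a) = q*a/c" "b*d*(c/a) = b*c*d/a" "c/a*a = c" "c/a*d = c*d/a" "q/(b*c/a) = q*a/(b*c)"
    "b*(c/a) = b*c/a"
    using nz by simp_all
  have den: "coeff_den q b d (c/a) a (3*Suc m) (2*Suc m) (2*Suc m) (2*Suc m)
      = coeff_den q b d (c/a) a (3*m) (2*m) (2*m) (2*m) * (u1*u2*u3*(p1*p2*p3)*(x1*x2)*(y1*y2)*(t1*t2))"
    unfolding coeff_den_def e qpoch_Suc Qp Qs ka u p x y t by (simp only: mult_ac)
  have nz2: "u1 \<noteq> 0" "u2 \<noteq> 0" "u3 \<noteq> 0" "p1 \<noteq> 0" "p2 \<noteq> 0" "p3 \<noteq> 0" "x1 \<noteq> 0" "x2 \<noteq> 0"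
    "y1 \<noteq> 0" "y2 \<noteq> 0" "t1 \<noteq> 0" "t2 \<noteq> 0"
    using nv[of "3*Suc m" "2*Suc m" "2*Suc m" "2*Suc m"] unfolding den by auto
  have d1: "1 - d \<noteq> 0" and r0: "r \<noteq> 0"
    using nd nz unfolding ar by auto
  have "qpoch (a/b) q 2 \<noteq> 0" "qpoch (a/c) q 2 \<noteq> 0"
    using nd by (auto simp: qpochs_def dest!: spec[of _ "Suc 0"])
  hence A0: "Ab \<noteq> 0" "Ac \<noteq> 0"
    unfolding r by (auto simp: qpoch_Suc numeral_2_eq_2)
  \<comment> \<open>The summand carries \<open>q\<close> to the power \<open>(3*n - 2)*n\<close>
    with \<open>n = m + 1\<close>; what exceeds \<open>3*m^2\<close> becomes
    \<open>Q^4*q\<close>.\<close>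
  have ex: "(3*m+1) * Suc m = 3*m^2 + (4*m + 1)"
    by (simp add: power2_eq_square)
  have P: "(q powi (3 * int (Suc m) - 2) * a^3/(b*c*d))^Suc m = q^(3*m^2) * (a^3/(b*c*d))^m * (Q^4*q*(a^3/(b*c*d)))"
  proof -
    have "(q powi (3 * int (Suc m) - 2))^Suc m = q^((3*m+1) * Suc m)"
      by (subst power_int_eq_power[of _ "3*m+1"]) (simp_all only: power_mult, simp)
    also have "\<dots> = q^(3*m^2) * (Q^4*q)"
      unfolding ex power_add Qp power_one_right by (rule refl)
    finally show ?thesis
      unfolding times_divide_eq_right[symmetric] power_mult_distrib power_Suc2[of "a^3/(b*c*d)"]
      by (simp only: mult_ac)
  qed
  \<comment> \<open>The coefficients contain these factorials from \<open>q*a/b\<close>,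
    \<open>q*a/c\<close>, \<open>q*a/(c*d)\<close> on, so the leading factor is split off; it
    cancels against \<open>W\<close>.\<close>
  have qp: "qpoch (a/b) q (2*Suc m) = Ab * qpoch (q*a/b) q (2*m) * x1"
    "qpoch (a/c) q (2*Suc m) = Ac * qpoch (q*a/c) q (2*m) * y1"
    "qpoch (a/(c*d)) q (Suc m) = r * qpoch (q*a/(c*d)) q m"
    unfolding e qpoch_Suc_head[of "a/b"] qpoch_Suc_head[of "a/c"] qpoch_Suc_head[of "a/(c*d)"] times_divide_eq_right
    unfolding qpoch_Suc r x y Qp by (simp_all only: mult_ac times_divide_eq_right)
  have B: "(q powi (3 * int (Suc m) - 2) * a^3/(b*c*d))^Suc m
     * ((qpochs [b, c, d, q*a/(b*c), q*a/(b*d), a/(c*d)] q (Suc m) * qpochs [b*c/a, b*d/a, c*d/a] q (2*Suc m))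
        / (qpochs [a/b, a/c, a/d] q (2*Suc m) * qpochs [q, b*c*d/a] q (3*Suc m)))
    = C m * (Q^4*q*(a^3/(b*c*d))) * (f1*f2*f3*g1*g2*r*(h1*h1')*(h2*h2')*(h3*h3') / (Ab*Ac*x1*y1*t1*t2*(u1*u2*u3)*(p1*p2*p3)))"
    unfolding P C_def coeff_num_eq[OF nz(2-5)] coeff_den_def ka qpochs_def list.map prod_list.Cons prod_list.Nil mult_1_right qp
    unfolding e qpoch_Suc Q1 Qp Qs f[symmetric] g[symmetric] h[symmetric] t[symmetric] u[symmetric] p[symmetric]
    by (simp only: times_divide_eq_left times_divide_eq_right divide_divide_eq_left divide_divide_eq_right mult_ac)
  have "Q^2 * (a - Q^2*(b*d)) / d = Q^2*(a/d)*h2"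
    using nz by (simp add: h field_simps)
  hence F: "shift_factor q b d (c/a) a Q = Q^2*(a/d)*f3*g1*h2*h3 / (u1*p1*x1*y1)"
    unfolding shift_factor_def ka by (simp only: f g h u p x y)
  have "Q^2*(q/(c/a)) = Q^2*(q*a/c)"
    using nz by simp
  hence G: "cd_factor q b d (c/a) a Q = Q^2*(q*a/c)*h3'*h1*g2*f2 / (t1*u2*p2*x2)"
    unfolding cd_factor_def ka by (simp only: f g h u p x t)
  have "q/(c*d/a) = q*a/(c*d)"
    using nz by simp
  hence H: "bd_factor q b d (c/a) a Q = q*Q^2*(q*a/b)*h2'*h1'*r'*f1 / (t2*u3*p3*y2)"
    unfolding bd_factor_def ka by (simp only: f r h u p t y)
  have CS: "C (Suc m) = C m * (Q^2*(a/d)*f3*g1*h2*h3 / (u1*p1*x1*y1)) * (Q^2*(q*a/c)*h3'*h1*g2*f2 / (t1*u2*p2*x2))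
         * (q*Q^2*(q*a/b)*h2'*h1'*r'*f1 / (t2*u3*p3*y2))"
    unfolding F[symmetric] G[symmetric] H[symmetric] unfolding C_def Q_def
    by (rule cleared_term_stage(1)[OF q nz(1,3,5) _ nz(2) nv]) (use nz in simp)
  have T: "cleared_term q b d (c/a) a m = coeff_tail q b d (c/a) a 0 0 0 0 * (C m * shift_factor q b d (c/a) a Q *
     ((1 - Q^2*(q/(c/a))) * (1 - q*Q^4*(c/a*a)) / (1 - Q^2*(a/d)) + cd_factor q b d (c/a) a Q *
       ((1 - q*Q^2*(q*a/b)) * (1 - q^2*Q^4*b) / (1 - q*Q^2*(a/d)))) + C (Suc m) * (1 - (q*Q)^4*d))"
    unfolding C_def Q_def
    by (rule cleared_term_stage(2)[OF q nz(1,3,5) _ nz(2) nv]) (use nz in simp)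
  have T': "cleared_term q b d (c/a) a m = coeff_tail q b d (c/a) a 0 0 0 0 *
     (C m * (Q^2*(a/d)*f3*g1*h2*h3 / (u1*p1*x1*y1)) * (y1*E1/t1 + (Q^2*(q*a/c)*h3'*h1*g2*f2 / (t1*u2*p2*x2)) * (x2*E2/t2))
       + C m * (Q^2*(a/d)*f3*g1*h2*h3 / (u1*p1*x1*y1)) * (Q^2*(q*a/c)*h3'*h1*g2*f2 / (t1*u2*p2*x2))
         * (q*Q^2*(q*a/b)*h2'*h1'*r'*f1 / (t2*u3*p3*y2)) * E3)"
    unfolding T CS F G unfolding ka x y t E by (rule refl)
  have "cleared_term q b d (c/a) a m / (coeff_tail q b d (c/a) a 0 0 0 0 * (1 - d)) = W q (Suc m) a b c d *
     (C m * (Q^4*q*(a^3/(b*c*d))) * (f1*f2*f3*g1*g2*r*(h1*h1')*(h2*h2')*(h3*h3') / (Ab*Ac*x1*y1*t1*t2*(u1*u2*u3)*(p1*p2*p3))))"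
    unfolding T' W summand_algebra[OF nz(2-5,1) Q0 A0 r0 d1 nz1(1,5,6,2,3,8,7,4) nz2] using D by simp
  thus ?thesis
    unfolding summand_def B[symmetric] by (simp only: mult.assoc)
qed

theorem theorem8:
  fixes q a b c d :: complex
  assumes "0 < norm q" and "norm q < 1"
    and "a \<noteq> 0" and "b \<noteq> 0" and "c \<noteq> 0" and "d \<noteq> 0"
    and "no_zero_denominator q a b c d"
  shows "summable (\<lambda>n. summand q (Suc n) a b c d) \<and>
    (qpoch_inf b q * qpoch_inf c q * qpoch_inf (q*d) q * qpoch_inf (q*a^2/(b*c*d)) q)
      / (qpoch_inf (q*a/b) q * qpoch_inf (q*a/c) q * qpoch_inf (a/d) q * qpoch_inf (b*c*d/a) q)
    = 1 + (\<Sum>n. summand q (Suc n) a b c d)"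
proof -
  define D where "D = coeff_tail q b d (c/a) a 0 0 0 0"
  have q0: "q \<noteq> 0" using assms(1) by auto
  \<comment> \<open>Apart from \<open>qpoch_inf q q\<close> this is the denominator of the left-hand
    side, so it is nonzero.\<close>
  have Deq: "D = qpoch_inf q q * qpoch_inf (q*a/b) q * qpoch_inf (q*a/c) q * qpoch_inf (b*c*d/a) q * qpoch_inf (a/d) q"
    unfolding D_def coeff_tail_def by (simp add: mult_ac)
  note nd = assms(7)[unfolded no_zero_denominator_def]
  have qq: "qpoch_inf q q \<noteq> 0"
    by (rule qpoch_inf_q_nonzero[OF assms(2)])
  have D0: "D \<noteq> 0"
    using nd qq by (simp add: Deq)
  have d1: "1 - d \<noteq> 0"
    using nd assms(6) by auto
  have s: "summand q (Suc m) a b c d = cleared_term q b d (c/a) a m / (D * (1 - d))" for m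
    unfolding D_def using summand_eq_cleared_term[OF assms(2) q0 assms(3-7)] D0 by (simp add: D_def)
  have sum: "summable (\<lambda>m. cleared_term q b d (c/a) a m)"
    by (rule suminf_entire(2)[OF cleared_term_holomorphic[OF assms(2)] norm_cleared_term_le[OF assms(2)]])
  have "qpoch_inf (q/(c/a)) q \<noteq> 0" "qpoch_inf (b*d*(c/a)) q \<noteq> 0"
    using nd by (simp_all add: mult_ac)
  from entire_identity[OF assms(1,2,4,6) _ this, of a]
  have "qpoch_inf q q * qpoch_inf d q * qpoch_inf b q * qpoch_inf c q * qpoch_inf (q*a^2/(b*c*d)) q
    = D * (1 - d) + (\<Sum>i. cleared_term q b d (c/a) a i)"
    using assms(3-6) by (simp add: D_def power2_eq_square mult_ac)
  \<comment> \<open>Division by \<open>1 - d\<close> turns the \<open>(d; q)\<close> of the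
    evaluation into the \<open>(q*d; q)\<close> of the theorem.\<close>
  moreover have "qpoch_inf d q = (1 - d) * qpoch_inf (q*d) q"
    using qpoch_inf_split[OF assms(2), of d 1] by (simp add: qpoch_Suc)
  ultimately have "qpoch_inf q q * (1 - d) * (qpoch_inf b q * qpoch_inf c q * qpoch_inf (q*d) q * qpoch_inf (q*a^2/(b*c*d)) q)
    = D * (1 - d) + (\<Sum>i. cleared_term q b d (c/a) a i)"
    by (simp only: mult_ac)
  moreover have "(\<Sum>n. summand q (Suc n) a b c d) = (\<Sum>i. cleared_term q b d (c/a) a i) / (D * (1 - d))"
    unfolding s by (rule suminf_divide[OF sum])
  ultimately have "1 + (\<Sum>n. summand q (Suc n) a b c d) = qpoch_inf q q * (1 - d)
      * (qpoch_inf b q * qpoch_inf c q * qpoch_inf (q*d) q * qpoch_inf (q*a^2/(b*c*d)) q) / (D * (1 - d))"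
    using D0 d1 by (simp add: add_divide_distrib)
  also have "\<dots> = (qpoch_inf b q * qpoch_inf c q * qpoch_inf (q*d) q * qpoch_inf (q*a^2/(b*c*d)) q)
      / (qpoch_inf (q*a/b) q * qpoch_inf (q*a/c) q * qpoch_inf (a/d) q * qpoch_inf (b*c*d/a) q)"
    unfolding Deq using qq d1 by (simp add: mult_ac)
  finally show ?thesis
    unfolding s using sum by simp
qed

end
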